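(* Assume $N\ge 1$, $k\ge 0$, $a>0$, $a+2\langle k\rangle+N>2$, and that at least one of the following holds: (i) $N=1$ and $a>0$; (ii) $a\in\{1,2\}$; (iii) $k\equiv 0$ and $a=\frac{2}{m}$ for some $m\in\mathbb{N}$. Let $p\in[1,2]$ and $p'=\frac{p}{p-1}$ (with $p'=\infty$ if $p=1$). Then $\|\mathcal{F}_{k,a}f\|_{L^{p'}_{k,a}}\le \|f\|_{L^p_{k,a}}$ for all $f\in L^p_{k,a}(\mathbb{R}^N)$.
   Context: Let $\langle\cdot,\cdot\rangle$, $\|\cdot\|$ be the Euclidean inner product and norm on $\mathbb{R}^N$. Let $\mathcal{R}\subset\mathbb{R}^N\setminus\{0\}$ be a reduced root system with positive subsystem $\mathcal{R}^+$, let $r_\alpha(x)=x-2\frac{\langle\alpha,x\rangle}{\|\alpha\|^2}\alpha$, let $\mathfrak{C}$ be the finite group generated by the $r_\alpha$, and let $k:\mathcal{R}\to[0,\infty)$, $\alpha\mapsto k_\alpha$, be a $\mathfrak{C}$-invariant (multiplicity) function; $\langle k\rangle=\sum_{\alpha\in\mathcal{R}^+}k_\alpha$. For $a>0$ put $\vartheta_k(x)=\prod_{\alpha\in\mathcal{R}^+}|\langle\alpha,x\rangle|^{2k_\alpha}$, $\vartheta_{k,a}(x)=\|x\|^{a-2}\vartheta_k(x)$, $d\mu_{k,a}(x)=\vartheta_{k,a}(x)\,dx$, $L^p_{k,a}(\mathbb{R}^N)=L^p(\mathbb{R}^N,\mu_{k,a})$. The Dunkl Laplacian is $\Delta_kf(x)=\Delta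 f(x)+\sum_{\alpha\in\mathcal{R}^+}k_\alpha\bigl(\frac{2\langle\nabla f(x),\alpha\rangle}{\langle\alpha,x\rangle}-\|\alpha\|^2\frac{f(x)-f(r_\alpha x)}{\langle\alpha,x\rangle^2}\bigr)$. If $a+2\langle k\rangle+N>2$, the $(k,a)$-generalized Fourier transform is the unitary operator on $L^2_{k,a}(\mathbb{R}^N)$ given by $\mathcal{F}_{k,a}=\exp\bigl[\frac{i\pi}{2a}(2\langle k\rangle+N+a-2)\bigr]\exp\bigl[\frac{i\pi}{2a}(\|x\|^{2-a}\Delta_k-\|x\|^a)\bigr]$. Equivalently, it is the unitary operator determined by $\mathcal{F}_{k,a}\Phi_{\ell}(p,\cdot)=e^{-i\pi(\ell+m/a)}\Phi_\ell(p,\cdot)$ for $\ell,m\in\{0,1,2,\dots\}$ and $p$ a homogeneous polynomial of degree $m$ with $\Delta_kp=0$, where $\Phi_\ell(p,x)=p(x)L_\ell^{(\lambda_m)}(\frac2a\|x\|^a)e^{-\|x\|^a/a}$, $\lambda_m=\frac1a(2m+2\langle k\rangle+N-2)$, and $L_\ell^{(\lambda)}$ are Laguerre polynomials (these functions span a dense subspace). Standing normalization: $\mathcal{F}_{k,a}$ is unitary on $L^2_{k,a}(\mathbb{R}^N)$ and satisfies $\|\mathcal{F}_{k,a}f\|_\infty\le\|f\|_{L^1_{k,a}}$ for all $f\in L^1_{k,a}\cap L^2_{k,a}$. It is extended by continuity to $L^1_{k,a}+L^2_{k,a}$, in particular to $L^p_{k,a}$ for $1\le p\le 2$. *)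

theory Defs
  imports "HOL-Analysis.Analysis" "HOL-Probability.Essential_Supremum"
begin

section \<open>Root systems and multiplicity functions\<close>

definition root_reflection :: "real^'n \<Rightarrow> real^'n \<Rightarrow> real^'n" where
  "root_reflection \<alpha> x = x - (2 * (\<alpha> \<bullet> x) / (norm \<alpha>)\<^sup>2) *\<^sub>R \<alpha>"

text \<open>As usual in Dunkl theory, the roots need neither span the space nor satisfy an
  integrality condition; the empty system is allowed.\<close>

definition reduced_root_system :: "(real^'n) set \<Rightarrow> bool" where
  "reduced_root_system R \<longleftrightarrow>
     finite R \<and> 0 \<notin> R \<and>
     (\<forall>\<alpha>\<in>R. R \<inter> span {\<alpha>} = {\<alpha>, -\<alpha>}) \<and>
     (\<forall>\<alpha>\<in>R. root_reflection \<alpha> ` R = R)"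

definition positive_subsystem :: "(real^'n) set \<Rightarrow> (real^'n) set \<Rightarrow> bool" where
  "positive_subsystem R Rp \<longleftrightarrow>
     (\<exists>\<beta>. (\<forall>\<alpha>\<in>R. \<alpha> \<bullet> \<beta> \<noteq> 0) \<and> Rp = {\<alpha>\<in>R. \<alpha> \<bullet> \<beta> > 0})"

text \<open>The generators are involutions, so closure under composition yields the generated group.\<close>

inductive_set reflection_group :: "(real^'n) set \<Rightarrow> (real^'n \<Rightarrow> real^'n) set"
  for R :: "(real^'n) set" where
  one: "id \<in> reflection_group R"
| step: "\<alpha> \<in> R \<Longrightarrow> g \<in> reflection_group R \<Longrightarrow> root_reflection \<alpha> \<circ> g \<in> reflection_group R"

definition multiplicity_function :: "(real^'n) set \<Rightarrow> (real^'n \<Rightarrow> real) \<Rightarrow> bool" where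
  "multiplicity_function R k \<longleftrightarrow>
     (\<forall>\<alpha>\<in>R. k \<alpha> \<ge> 0) \<and> (\<forall>g\<in>reflection_group R. \<forall>\<alpha>\<in>R. k (g \<alpha>) = k \<alpha>)"

definition mult_sum :: "(real^'n) set \<Rightarrow> (real^'n \<Rightarrow> real) \<Rightarrow> real" where
  "mult_sum Rp k = (\<Sum>\<alpha>\<in>Rp. k \<alpha>)"


section \<open>The weighted measure and its Lebesgue spaces\<close>

text \<open>Since \<open>0 powr s = 0\<close> for every \<open>s\<close>, the weight vanishes at the origin and on all root
  hyperplanes, also when an exponent is zero or negative; this only concerns a null set.\<close>

definition ka_weight :: "(real^'n) set \<Rightarrow> (real^'n \<Rightarrow> real) \<Rightarrow> real \<Rightarrow> real^'n \<Rightarrow> real" where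
  "ka_weight Rp k a x = norm x powr (a - 2) * (\<Prod>\<alpha>\<in>Rp. \<bar>\<alpha> \<bullet> x\<bar> powr (2 * k \<alpha>))"

definition ka_measure :: "(real^'n) set \<Rightarrow> (real^'n \<Rightarrow> real) \<Rightarrow> real \<Rightarrow> (real^'n) measure" where
  "ka_measure Rp k a = density lborel (\<lambda>x. ennreal (ka_weight Rp k a x))"

text \<open>Extended-valued norms for exponents \<open>1 \<le> p \<le> \<infinity>\<close>. Elements of the spaces are functions;
  equality of functions almost everywhere is made explicit wherever it matters.\<close>

definition Lp_norm :: "'a measure \<Rightarrow> ennreal \<Rightarrow> ('a \<Rightarrow> complex) \<Rightarrow> ennreal" where
  "Lp_norm M p f =
     (if p = \<infinity> then esssup M (\<lambda>x. ennreal (cmod (f x)))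
      else let I = (\<integral>\<^sup>+x. ennreal (cmod (f x) powr enn2real p) \<partial>M)
           in if I = \<infinity> then \<infinity> else ennreal (enn2real I powr (1 / enn2real p)))"

definition Lp_space :: "'a measure \<Rightarrow> ennreal \<Rightarrow> ('a \<Rightarrow> complex) set" where
  "Lp_space M p = {f \<in> borel_measurable M. Lp_norm M p f < \<infinity>}"

definition conj_exponent :: "real \<Rightarrow> ennreal" where
  "conj_exponent p = (if p = 1 then \<infinity> else ennreal (p / (p - 1)))"


section \<open>The Dunkl Laplacian and its homogeneous harmonic polynomials\<close>

definition laplacian :: "(real^'n \<Rightarrow> complex) \<Rightarrow> real^'n \<Rightarrow> complex" where
  "laplacian f x =
     (\<Sum>b\<in>Basis. frechet_derivative (\<lambda>y. frechet_derivative f (at y) b) (at x) b)"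

text \<open>Only meaningful off the root hyperplanes. The derivative of \<open>f\<close> at \<open>x\<close> applied to \<open>\<alpha>\<close>
  is the pairing of the gradient with \<open>\<alpha>\<close>.\<close>

definition dunkl_laplacian ::
    "(real^'n) set \<Rightarrow> (real^'n \<Rightarrow> real) \<Rightarrow> (real^'n \<Rightarrow> complex) \<Rightarrow> real^'n \<Rightarrow> complex" where
  "dunkl_laplacian Rp k f x = laplacian f x +
     (\<Sum>\<alpha>\<in>Rp. of_real (k \<alpha>) *
        (2 * frechet_derivative f (at x) \<alpha> / of_real (\<alpha> \<bullet> x)
         - of_real ((norm \<alpha>)\<^sup>2) * (f x - f (root_reflection \<alpha> x)) / of_real ((\<alpha> \<bullet> x)\<^sup>2)))"

text \<open>For a polynomial \<open>q\<close> the Dunkl Laplacian is a polynomial off the root hyperplanes, so it is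
  the zero polynomial iff it vanishes there.\<close>

definition dunkl_harmonic ::
    "(real^'n) set \<Rightarrow> (real^'n \<Rightarrow> real) \<Rightarrow> nat \<Rightarrow> (real^'n \<Rightarrow> complex) set" where
  "dunkl_harmonic Rp k m =
     {q. polynomial_function q \<and> (\<forall>c x. q (c *\<^sub>R x) = of_real (c ^ m) * q x) \<and>
         (\<forall>x. (\<forall>\<alpha>\<in>Rp. \<alpha> \<bullet> x \<noteq> 0) \<longrightarrow> dunkl_laplacian Rp k q x = 0)}"


section \<open>The generalized Fourier transform\<close>

definition laguerre :: "nat \<Rightarrow> real \<Rightarrow> real \<Rightarrow> real" where
  "laguerre l \<nu> t =
     (\<Sum>j\<le>l. (-1) ^ j * ((real l + \<nu>) gchoose (l - j)) * t ^ j / fact j)"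

definition ka_lambda :: "(real^'n) set \<Rightarrow> (real^'n \<Rightarrow> real) \<Rightarrow> real \<Rightarrow> nat \<Rightarrow> real" where
  "ka_lambda Rp k a m = (2 * real m + 2 * mult_sum Rp k + real CARD('n) - 2) / a"

definition ka_eigenfunction ::
    "(real^'n) set \<Rightarrow> (real^'n \<Rightarrow> real) \<Rightarrow> real \<Rightarrow> nat \<Rightarrow> nat \<Rightarrow> (real^'n \<Rightarrow> complex)
      \<Rightarrow> real^'n \<Rightarrow> complex" where
  "ka_eigenfunction Rp k a l m q x =
     q x * of_real (laguerre l (ka_lambda Rp k a m) (2 / a * norm x powr a)
                    * exp (- (norm x powr a) / a))"

text \<open>Operators act on representatives. Additivity, homogeneity and preservation of the inner
  product make the action well defined on classes modulo equality almost everywhere.\<close>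

definition unitary_on_L2 ::
    "'a measure \<Rightarrow> (('a \<Rightarrow> complex) \<Rightarrow> ('a \<Rightarrow> complex)) \<Rightarrow> bool" where
  "unitary_on_L2 M F \<longleftrightarrow>
     (\<forall>f\<in>Lp_space M 2. F f \<in> Lp_space M 2) \<and>
     (\<forall>f\<in>Lp_space M 2. \<forall>g\<in>Lp_space M 2. \<forall>c d.
        AE x in M. F (\<lambda>y. c * f y + d * g y) x = c * F f x + d * F g x) \<and>
     (\<forall>f\<in>Lp_space M 2. \<forall>g\<in>Lp_space M 2.
        (\<integral>x. F f x * cnj (F g x) \<partial>M) = (\<integral>x. f x * cnj (g x) \<partial>M)) \<and>
     (\<forall>g\<in>Lp_space M 2. \<exists>f\<in>Lp_space M 2. AE x in M. F f x = g x)"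

text \<open>The eigenfunctions span a dense subspace, so this determines the transform uniquely up to
  equality almost everywhere.\<close>

definition is_ka_fourier ::
    "(real^'n) set \<Rightarrow> (real^'n \<Rightarrow> real) \<Rightarrow> real
      \<Rightarrow> ((real^'n \<Rightarrow> complex) \<Rightarrow> (real^'n \<Rightarrow> complex)) \<Rightarrow> bool" where
  "is_ka_fourier Rp k a F \<longleftrightarrow>
     unitary_on_L2 (ka_measure Rp k a) F \<and>
     (\<forall>l m. \<forall>q\<in>dunkl_harmonic Rp k m.
        AE x in ka_measure Rp k a.
          F (ka_eigenfunction Rp k a l m q) x =
          exp (- \<i> * of_real (pi * (real l + real m / a))) * ka_eigenfunction Rp k a l m q x)"

text \<open>Let \<open>F\<close> be linear on \<open>L\<^sup>2\<close> and bounded from \<open>L\<^sup>1 \<inter> L\<^sup>2\<close> with the \<open>L\<^sup>1\<close> norm to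
  \<open>L\<^sup>\<infinity>\<close>. For \<open>f = g + h\<close> with \<open>g \<in> L\<^sup>1\<close> and \<open>h \<in> L\<^sup>2\<close> the extended operator maps \<open>f\<close> to
  \<open>v + F h\<close>, where \<open>v\<close> is the \<open>L\<^sup>\<infinity>\<close>-limit of \<open>F (s n)\<close> for a sequence \<open>s\<close> in \<open>L\<^sup>1 \<inter> L\<^sup>2\<close>
  converging to \<open>g\<close> in \<open>L\<^sup>1\<close>. The result exists and, up to equality almost everywhere, depends
  neither on the decomposition nor on the sequence; a representative is selected.\<close>

definition is_extension_value ::
    "'a measure \<Rightarrow> (('a \<Rightarrow> complex) \<Rightarrow> ('a \<Rightarrow> complex))
      \<Rightarrow> ('a \<Rightarrow> complex) \<Rightarrow> ('a \<Rightarrow> complex) \<Rightarrow> bool" where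
  "is_extension_value M F f u \<longleftrightarrow>
     u \<in> borel_measurable M \<and>
     (\<exists>g\<in>Lp_space M 1. \<exists>h\<in>Lp_space M 2. \<exists>v\<in>Lp_space M \<infinity>. \<exists>s.
        (AE x in M. f x = g x + h x) \<and>
        (\<forall>n::nat. s n \<in> Lp_space M 1 \<inter> Lp_space M 2) \<and>
        (\<lambda>n. Lp_norm M 1 (\<lambda>x. s n x - g x)) \<longlonglongrightarrow> 0 \<and>
        (\<lambda>n. Lp_norm M \<infinity> (\<lambda>x. F (s n) x - v x)) \<longlonglongrightarrow> 0 \<and>
        (AE x in M. u x = v x + F h x))"

definition extend_L1_L2 ::
    "'a measure \<Rightarrow> (('a \<Rightarrow> complex) \<Rightarrow> ('a \<Rightarrow> complex))
      \<Rightarrow> ('a \<Rightarrow> complex) \<Rightarrow> ('a \<Rightarrow> complex)" where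
  "extend_L1_L2 M F f = (SOME u. is_extension_value M F f u)"

end

theory Submission
  imports Defs "HOL-Complex_Analysis.Complex_Analysis"
begin

text \<open>Only two properties of the transform \<open>F\<close> matter: it is unitary on \<open>L\<^sup>2\<close> and contracts
  \<open>L\<^sup>1 \<inter> L\<^sup>2\<close> into \<open>L\<^sup>\<infinity>\<close>. Riesz--Thorin interpolation of the bilinear form \<open>\<integral> F f \<cdot> g\<close> on simple
  functions bounds it by the product of the \<open>L\<^sup>p\<close> norms of \<open>f\<close> and \<open>g\<close>. By surjectivity every simple
  \<open>\<phi>\<close> has a transpose \<open>\<psi> \<in> L\<^sup>2\<close> with \<open>\<integral> F h \<cdot> \<phi> = \<integral> h \<cdot> \<psi>\<close>, and the bilinear bound gives
  \<open>\<parallel>\<psi>\<parallel>\<^sub>q \<le> \<parallel>\<phi>\<parallel>\<^sub>p\<close> for the conjugate exponent \<open>q\<close> as well as \<open>\<psi> \<in> L\<^sup>\<infinity>\<close>. Hence every value \<open>u\<close> of the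
  extended operator at \<open>f \<in> L\<^sup>p\<close> satisfies \<open>\<integral> u \<cdot> \<phi> = \<integral> f \<cdot> \<psi>\<close>, and Hoelder's inequality
  followed by duality yields \<open>\<parallel>u\<parallel>\<^sub>q \<le> \<parallel>f\<parallel>\<^sub>p\<close>.\<close>

section \<open>Interpolation of bilinear forms\<close>

text \<open>Hadamard's three lines theorem, normalized to edge bound 1. The factor
  \<open>exp (\<epsilon> * (z\<^sup>2 - 1))\<close> decays as the imaginary part grows, so the
  maximum modulus principle on a tall rectangle bounds the damped function by 1; afterwards
  \<epsilon> tends to 0. The constant \<open>K\<close> influences only the height of the rectangle,
  not the final bound.\<close>

lemma three_lines_unit:
  fixes f :: "complex \<Rightarrow> complex"
  assumes hol: "f holomorphic_on UNIV"
    and bdd: "\<And>z. 0 \<le> Re z \<Longrightarrow> Re z \<le> 1 \<Longrightarrow> cmod (f z) \<le> K"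
    and edge: "\<And>z. Re z = 0 \<or> Re z = 1 \<Longrightarrow> cmod (f z) \<le> 1"
    and w: "0 \<le> Re w" "Re w \<le> 1"
  shows "cmod (f w) \<le> 1"
proof -
  have K: "K \<ge> 0" using bdd[OF w] norm_ge_zero order_trans by blast
  have main: "cmod (f w) * exp (\<epsilon> * Re (w\<^sup>2 - 1)) \<le> 1" if \<epsilon>: "\<epsilon> > 0" for \<epsilon> :: real
  proof -
    define g where "g z = f z * exp (of_real \<epsilon> * (z\<^sup>2 - 1))" for z
    have ng: "cmod (g z) = cmod (f z) * exp (\<epsilon> * Re (z\<^sup>2 - 1))" for z
      by (simp add: g_def norm_mult)
    \<comment> \<open>Subtracting 1 compensates the square of the real part, which is at most 1 on
      the strip, so the damping factor never exceeds 1 there.\<close>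
    have re: "Re (z\<^sup>2 - 1) \<le> - (Im z)\<^sup>2" if "0 \<le> Re z" "Re z \<le> 1" for z
      using that by (simp add: power2_eq_square mult_le_one)
    have "((\<lambda>Y. K * exp (- \<epsilon> * Y\<^sup>2)) \<longlongrightarrow> 0) at_top"
      using \<epsilon> by real_asymp
    then have "eventually (\<lambda>Y. K * exp (- \<epsilon> * Y\<^sup>2) < 1) at_top"
      by (rule order_tendstoD) simp
    \<comment> \<open>At height \<open>Y\<close> the damping outweighs \<open>K\<close>, which
      settles the horizontal edges; the second condition puts \<open>w\<close> inside the
      rectangle.\<close>
    then obtain Y where Y: "K * exp (- \<epsilon> * Y\<^sup>2) < 1" "Y > \<bar>Im w\<bar>"
      using eventually_happens[OF eventually_conj[OF _ eventually_gt_at_top[of "\<bar>Im w\<bar>"]]]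
      by (metis trivial_limit_at_top_linorder)
    let ?S = "cbox (Complex 0 (-Y)) (Complex 1 Y)"
    have "cmod (g w) \<le> 1"
    proof (rule maximum_modulus_frontier[of g ?S])
      have "g holomorphic_on UNIV" unfolding g_def by (intro holomorphic_intros hol)
      then show "g holomorphic_on interior ?S" "continuous_on (closure ?S) g"
        by (auto intro: holomorphic_on_subset holomorphic_on_imp_continuous_on continuous_on_subset)
      show "bounded ?S" by simp
      show "w \<in> ?S" using w Y by (auto simp: in_cbox_complex_iff)
      fix z assume "z \<in> frontier ?S"
      then have z: "z \<in> ?S" "z \<notin> box (Complex 0 (-Y)) (Complex 1 Y)"
        by (auto simp: frontier_def interior_cbox)
      then have z1: "0 \<le> Re z" "Re z \<le> 1" "\<bar>Im z\<bar> \<le> Y" by (auto simp: in_cbox_complex_iff)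
      from z have "(Re z = 0 \<or> Re z = 1) \<or> \<bar>Im z\<bar> = Y"
        by (auto simp: in_cbox_complex_iff in_box_complex_iff)
      then show "cmod (g z) \<le> 1"
      proof
        assume "Re z = 0 \<or> Re z = 1"
        then have "cmod (f z) \<le> 1" by (rule edge)
        moreover have "\<epsilon> * Re (z\<^sup>2 - 1) \<le> 0"
          using re[OF z1(1,2)] \<epsilon> zero_le_power2[of "Im z"]
          by (intro mult_nonneg_nonpos) linarith+
        ultimately show ?thesis unfolding ng by (intro mult_le_one) auto
      next
        assume "\<bar>Im z\<bar> = Y"
        then have "(Im z)\<^sup>2 = Y\<^sup>2" by (metis power2_abs)
        then have "\<epsilon> * Re (z\<^sup>2 - 1) \<le> \<epsilon> * (- Y\<^sup>2)"
          using re[OF z1(1,2)] \<epsilon> by (intro mult_left_mono) auto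
        then have "cmod (g z) \<le> K * exp (\<epsilon> * (- Y\<^sup>2))"
          unfolding ng using bdd[OF z1(1,2)] K by (intro mult_mono) auto
        then show ?thesis using Y by simp
      qed
    qed
    then show ?thesis by (simp add: ng)
  qed
  have "((\<lambda>\<epsilon>. cmod (f w) * exp (\<epsilon> * Re (w\<^sup>2 - 1))) \<longlongrightarrow> cmod (f w) * exp (0 * Re (w\<^sup>2 - 1))) (at_right 0)"
    by (intro tendsto_intros)
  then have "((\<lambda>\<epsilon>. cmod (f w) * exp (\<epsilon> * Re (w\<^sup>2 - 1))) \<longlongrightarrow> cmod (f w)) (at_right 0)" by simp
  then show ?thesis
    by (rule tendsto_upperbound)
       (use main in \<open>auto simp: eventually_at_filter intro!: always_eventually\<close>)
qed

text \<open>Young's inequality applied pointwise gives integrability. For the sharp constant it is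
  applied to \<open>f\<close> and \<open>g\<close> divided by their norms \<open>a\<close> and
  \<open>d\<close>, so that after integration the right side is
  \<open>a * d * (1 / p + 1 / q)\<close>. If one norm vanishes, the product is zero almost
  everywhere.\<close>

lemma Holder_integral:
  fixes f g :: "'a \<Rightarrow> complex"
  assumes pq: "1 < p" "1 < q" "1 / p + 1 / q = 1"
    and [measurable]: "f \<in> borel_measurable M" "g \<in> borel_measurable M"
    and f: "integrable M (\<lambda>x. cmod (f x) powr p)" and g: "integrable M (\<lambda>x. cmod (g x) powr q)"
  shows "integrable M (\<lambda>x. f x * g x)"
    and "cmod (\<integral>x. f x * g x \<partial>M)
      \<le> (\<integral>x. cmod (f x) powr p \<partial>M) powr (1 / p) * (\<integral>x. cmod (g x) powr q \<partial>M) powr (1 / q)"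
proof -
  have Y: "a * b \<le> a powr p / p + b powr q / q" if "a \<ge> 0" "b \<ge> 0" for a b
    using Youngs_inequality[OF pq that] .
  show int: "integrable M (\<lambda>x. f x * g x)"
    by (rule Bochner_Integration.integrable_bound[of _ "\<lambda>x. cmod (f x) powr p / p + cmod (g x) powr q / q"])
       (use pq f g in \<open>auto simp: norm_mult intro!: order_trans[OF Y]\<close>)
  define A where "A = (\<integral>x. cmod (f x) powr p \<partial>M)"
  define D where "D = (\<integral>x. cmod (g x) powr q \<partial>M)"
  have AD: "A \<ge> 0" "D \<ge> 0" by (auto simp: A_def D_def)
  show "cmod (\<integral>x. f x * g x \<partial>M) \<le> A powr (1 / p) * D powr (1 / q)"
  proof (cases "A = 0 \<or> D = 0")
    case True
    then have "AE x in M. f x * g x = 0"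
      using integral_nonneg_eq_0_iff_AE[OF f] integral_nonneg_eq_0_iff_AE[OF g]
      by (auto simp: A_def D_def)
    then have "(\<integral>x. f x * g x \<partial>M) = (\<integral>x. 0 \<partial>M)" by (intro integral_cong_AE) auto
    then show ?thesis by simp
  next
    case False
    with AD have AD: "A > 0" "D > 0" by auto
    define a d where "a = A powr (1 / p)" and "d = D powr (1 / q)"
    have ad: "a > 0" "d > 0" "a powr p = A" "d powr q = D"
      using AD pq by (auto simp: a_def d_def powr_powr)
    have "cmod (\<integral>x. f x * g x \<partial>M) \<le> (\<integral>x. cmod (f x * g x) \<partial>M)"
      by (rule integral_norm_bound)
    also have "\<dots> \<le> (\<integral>x. a * d * (cmod (f x) powr p / (A * p) + cmod (g x) powr q / (D * q)) \<partial>M)"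
    proof (rule integral_mono)
      fix x
      have "(cmod (f x) / a) * (cmod (g x) / d) \<le> (cmod (f x) / a) powr p / p + (cmod (g x) / d) powr q / q"
        using ad by (intro Y) auto
      also have "\<dots> = cmod (f x) powr p / (A * p) + cmod (g x) powr q / (D * q)"
        using ad by (simp add: powr_divide)
      finally show "cmod (f x * g x) \<le> a * d * (cmod (f x) powr p / (A * p) + cmod (g x) powr q / (D * q))"
        using ad by (simp add: norm_mult field_simps)
    qed (use int f g in auto)
    also have "\<dots> = a * d * (1 / p + 1 / q)"
      using f g AD pq by (simp add: A_def[symmetric] D_def[symmetric])
    finally show ?thesis using pq by (simp add: a_def d_def)
  qed
qed

section \<open>Simple functions and their level sets\<close>

lemma simple_bochner_integrable_powr:
  fixes f :: "'a \<Rightarrow> complex"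
  assumes "Bochner_Integration.simple_bochner_integrable M f"
  shows "integrable M (\<lambda>x. cmod (f x) powr s)"
proof (rule integrableI_simple_bochner_integrable)
  show "Bochner_Integration.simple_bochner_integrable M (\<lambda>x. cmod (f x) powr s)"
    using simple_bochner_integrable_compose2[where p = "\<lambda>u v. cmod u powr s", OF _ assms assms] by simp
qed

text \<open>A level set at a nonzero value lies in the support and hence has finite measure. These
  indicators are the pieces into which the deformed functions of the interpolation argument
  decompose.\<close>

lemma simple_bochner_integrable_level_set:
  fixes f :: "'a \<Rightarrow> complex"
  assumes f: "Bochner_Integration.simple_bochner_integrable M f" and c: "c \<noteq> 0"
  shows "Bochner_Integration.simple_bochner_integrable M (indicator {x\<in>space M. f x = c} :: 'a \<Rightarrow> complex)"
proof -
  have sf: "simple_function M f" and fin: "emeasure M {x\<in>space M. f x \<noteq> 0} \<noteq> \<infinity>"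
    using f by (auto elim: Bochner_Integration.simple_bochner_integrable.cases)
  have [measurable]: "{x\<in>space M. f x = c} \<in> sets M" "f \<in> borel_measurable M"
    using sf by (auto intro: borel_measurable_simple_function)
  have "emeasure M {x\<in>space M. (indicator {x\<in>space M. f x = c} x :: complex) \<noteq> 0} \<le> emeasure M {x\<in>space M. f x \<noteq> 0}"
    using c by (intro emeasure_mono) (auto simp: indicator_def)
  with fin show ?thesis
    by (intro Bochner_Integration.simple_bochner_integrable.intros simple_function_indicator) (auto simp: top_unique)
qed

text \<open>Riesz--Thorin interpolation between the exponents 1 and 2. With \<open>z\<close> in the unit strip, \<open>f\<close>
  is deformed to \<open>sgn f \<bar>f\<bar>\<^bsup>p(1 - z/2)\<^esup>\<close>, which is \<open>f\<close> itself for \<open>z = 2 - 2/p\<close>.\<close>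

lemma bilinear_interpolation:
  fixes M :: "'a measure" and B :: "('a \<Rightarrow> complex) \<Rightarrow> ('a \<Rightarrow> complex) \<Rightarrow> complex"
  defines "V \<equiv> {f. Bochner_Integration.simple_bochner_integrable M f}"
  assumes linl: "\<And>f g h c. f \<in> V \<Longrightarrow> g \<in> V \<Longrightarrow> h \<in> V \<Longrightarrow> B (\<lambda>x. f x + c * g x) h = B f h + c * B g h"
    and linr: "\<And>f g h c. f \<in> V \<Longrightarrow> g \<in> V \<Longrightarrow> h \<in> V \<Longrightarrow> B h (\<lambda>x. f x + c * g x) = B h f + c * B h g"
    and b1: "\<And>f g. f \<in> V \<Longrightarrow> g \<in> V \<Longrightarrow> cmod (B f g) \<le> (\<integral>x. cmod (f x) \<partial>M) * (\<integral>x. cmod (g x) \<partial>M)"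
    and b2: "\<And>f g. f \<in> V \<Longrightarrow> g \<in> V \<Longrightarrow>
      cmod (B f g) \<le> sqrt (\<integral>x. (cmod (f x))\<^sup>2 \<partial>M) * sqrt (\<integral>x. (cmod (g x))\<^sup>2 \<partial>M)"
    and p: "1 \<le> p" "p \<le> 2" and f: "f \<in> V" and g: "g \<in> V"
  shows "cmod (B f g) \<le> (\<integral>x. cmod (f x) powr p \<partial>M) powr (1 / p) * (\<integral>x. cmod (g x) powr p \<partial>M) powr (1 / p)"
proof -
  define e where "e f c = (indicator {x\<in>space M. f x = c} :: 'a \<Rightarrow> complex)" for f and c :: complex
  define S where "S f = f ` space M - {0}" for f :: "'a \<Rightarrow> complex"
  \<comment> \<open>For nonzero \<open>c\<close> this is \<open>sgn c\<close> times the power of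
    \<open>cmod c\<close> with complex exponent p(1 - z/2). The exponential form is entire in
    \<open>z\<close>, and the factor \<open>c\<close> in front makes the value at 0 equal to
    0.\<close>
  define H where "H z c = c * exp (of_real (ln (cmod c)) * (of_real p * (1 - z / 2) - 1))" for z c :: complex
  define d where "d f z = (\<lambda>x. \<Sum>c\<in>S f. H z c * e f c x)" for f z
  have V0: "(\<lambda>x. 0) \<in> V"
    unfolding V_def by (auto intro!: Bochner_Integration.simple_bochner_integrable.intros)
  have Vlin: "(\<lambda>x. u x + c * v x) \<in> V" if "u \<in> V" "v \<in> V" for u v c
    using that simple_bochner_integrable_compose2[where p = "\<lambda>a b. a + c * b"] by (simp add: V_def)
  have eV: "e f c \<in> V" if "f \<in> V" "c \<in> S f" for f c
    using simple_bochner_integrable_level_set[of M f c] that by (auto simp: e_def V_def S_def)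
  have fin: "finite (S f)" if "f \<in> V" for f
    using that by (auto simp: V_def S_def elim!: Bochner_Integration.simple_bochner_integrable.cases dest: simple_functionD)
  have sumV: "(\<lambda>x. \<Sum>c\<in>A. a c * v c x) \<in> V" if "finite A" "\<And>c. c \<in> A \<Longrightarrow> v c \<in> V"
    for A :: "complex set" and a v
    using that
  proof (induction A)
    case (insert c A)
    then show ?case
      using Vlin[of "\<lambda>x. \<Sum>c\<in>A. a c * v c x" "v c" "a c"] by (simp add: add.commute)
  qed (simp add: V0)
  \<comment> \<open>The inductions over finite sums start from the zero function, where the L^1
    bound forces \<open>B\<close> to vanish.\<close>
  have Bz: "B (\<lambda>x. 0) h = 0" "B h (\<lambda>x. 0) = 0" if "h \<in> V" for h
    using b1[OF V0 that] b1[OF that V0] by auto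
  have suml: "B (\<lambda>x. \<Sum>c\<in>A. a c * v c x) h = (\<Sum>c\<in>A. a c * B (v c) h)"
    if "finite A" "\<And>c. c \<in> A \<Longrightarrow> v c \<in> V" "h \<in> V" for A :: "complex set" and a v h
    using that
  proof (induction A)
    case (insert c A)
    then show ?case
      using linl[OF sumV[of A v a], of "v c" h "a c"] by (simp add: add.commute)
  qed (simp add: Bz)
  have sumr: "B h (\<lambda>x. \<Sum>c\<in>A. a c * v c x) = (\<Sum>c\<in>A. a c * B h (v c))"
    if "finite A" "\<And>c. c \<in> A \<Longrightarrow> v c \<in> V" "h \<in> V" for A :: "complex set" and a v h
    using that
  proof (induction A)
    case (insert c A)
    then show ?case
      using linr[OF sumV[of A v a], of "v c" h "a c"] by (simp add: add.commute)
  qed (simp add: Bz)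
  have dV: "d f z \<in> V" if "f \<in> V" for f z
    unfolding d_def by (rule sumV) (use that fin eV in auto)
  have d_eq: "d f z x = H z (f x)" if "f \<in> V" "x \<in> space M" for f z x
  proof -
    have "d f z x = (\<Sum>c\<in>S f. if f x = c then H z c else 0)"
      unfolding d_def e_def using that by (intro sum.cong) auto
    also have "\<dots> = H z (f x)"
      using fin[OF that(1)] that(2) by (auto simp: S_def H_def)
    finally show ?thesis .
  qed
  have nH: "cmod (H z c) = cmod c powr (p * (1 - Re z / 2))" for z c
  proof (cases "c = 0")
    case False
    then have "cmod (H z c) = exp (ln (cmod c)) * exp (ln (cmod c) * (p * (1 - Re z / 2) - 1))"
      by (simp add: H_def norm_mult)
    also have "\<dots> = exp (ln (cmod c) + ln (cmod c) * (p * (1 - Re z / 2) - 1))"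
      by (simp add: exp_add)
    also have "\<dots> = cmod c powr (p * (1 - Re z / 2))"
      using False by (simp add: powr_def algebra_simps)
    finally show ?thesis .
  qed (simp add: H_def)
  define t where "t = 2 - 2 / p"
  have t: "0 \<le> t" "t \<le> 1" "1 - t / 2 = 1 / p" using p by (auto simp: t_def field_simps)
  have Ht: "H (of_real t) c = c" for c
  proof -
    have "of_real p * (1 - of_real t / 2) = (of_real (p * (1 - t / 2)) :: complex)" by simp
    also have "\<dots> = 1" using t p by simp
    finally show ?thesis by (simp add: H_def)
  qed
  define I where "I f = (\<integral>x. cmod (f x) powr p \<partial>M)" for f :: "'a \<Rightarrow> complex"
  define G where "G z = B (d f z) (d g z)" for z
  \<comment> \<open>Expanding both arguments over their finitely many level sets turns
    \<open>G\<close> into a finite combination of products of exponentials in \<open>z\<close>.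
    Holomorphy and boundedness on the strip are both read off from this form.\<close>
  have G_eq: "G z = (\<Sum>c\<in>S f. H z c * (\<Sum>c'\<in>S g. H z c' * B (e f c) (e g c')))" for z
  proof -
    have "G z = (\<Sum>c\<in>S f. H z c * B (e f c) (d g z))"
      unfolding G_def using suml[where v = "e f" and a = "H z", OF fin[OF f] eV[OF f] dV[OF g]] by (simp add: d_def[of f])
    also have "\<dots> = (\<Sum>c\<in>S f. H z c * (\<Sum>c'\<in>S g. H z c' * B (e f c) (e g c')))"
      using sumr[where v = "e g" and a = "H z", OF fin[OF g] eV[OF g] eV[OF f]] by (intro sum.cong) (simp_all add: d_def[of g])
    finally show ?thesis .
  qed
  have holG: "G holomorphic_on UNIV"
    unfolding G_eq H_def by (intro holomorphic_intros) auto
  \<comment> \<open>On the edge Re z = 0 the deformed function has modulus |f|^p, on Re z = 1 it has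
    modulus |f|^(p/2). Thus its L^1 norm and its squared L^2 norm on the respective edges both equal
    \<open>I f\<close>.\<close>
  have int1: "(\<integral>x. cmod (d f z x) \<partial>M) = I f" if "f \<in> V" "Re z = 0" for f z
    unfolding I_def by (rule Bochner_Integration.integral_cong) (use that in \<open>auto simp: d_eq nH\<close>)
  have int2: "(\<integral>x. (cmod (d f z x))\<^sup>2 \<partial>M) = I f" if "f \<in> V" "Re z = 1" for f z
    unfolding I_def by (rule Bochner_Integration.integral_cong)
      (use that in \<open>auto simp: d_eq nH power2_eq_square powr_add[symmetric]\<close>)
  \<comment> \<open>The deformation at \<open>t\<close> agrees with the original function on
    \<open>space M\<close> but is 0 elsewhere, so the two need not be equal as functions. Their
    difference has L^1 norm zero, and the L^1 bound shows that \<open>B\<close> does not see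
    it.\<close>
  have Idiff: "B f g = G (of_real t)"
  proof -
    have z: "(\<integral>x. cmod (u x + - 1 * d u (of_real t) x) \<partial>M) = 0" if "u \<in> V" for u
    proof -
      have "(\<integral>x. cmod (u x + - 1 * d u (of_real t) x) \<partial>M) = (\<integral>x. 0 \<partial>M)"
        by (rule Bochner_Integration.integral_cong) (use that in \<open>auto simp: d_eq Ht\<close>)
      then show ?thesis by simp
    qed
    have "B f g + - 1 * B (d f (of_real t)) g = 0"
      using b1[OF Vlin[OF f dV[OF f, of "of_real t"], of "-1"] g] linl[OF f dV[OF f, of "of_real t"] g, of "-1"]
      by (simp only: z[OF f] mult_zero_left norm_le_zero_iff)
    moreover have "B (d f (of_real t)) g + - 1 * B (d f (of_real t)) (d g (of_real t)) = 0"
      using b1[OF dV[OF f, of "of_real t"] Vlin[OF g dV[OF g, of "of_real t"], of "-1"]] linr[OF g dV[OF g, of "of_real t"] dV[OF f, of "of_real t"], of "-1"]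
      by (simp only: z[OF g] mult_zero_right norm_le_zero_iff)
    ultimately show ?thesis by (simp add: G_def)
  qed
  have I0: "I f \<ge> 0" for f unfolding I_def by simp
  show ?thesis
  proof (cases "I f * I g = 0")
    \<comment> \<open>The normalization below divides by powers of \<open>I f * I g\<close>. If this
      product is zero, one function vanishes almost everywhere and the L^1 bound already gives the
      claim.\<close>
    case True
    have null: "(\<integral>x. cmod (u x) \<partial>M) = 0" if "u \<in> V" "I u = 0" for u
    proof -
      have "AE x in M. cmod (u x) powr p = 0"
        using that simple_bochner_integrable_powr[of M u p]
        by (subst integral_nonneg_eq_0_iff_AE[symmetric]) (auto simp: I_def V_def)
      then have "AE x in M. cmod (u x) = 0" by auto
      then show ?thesis by (rule integral_eq_zero_AE)
    qed
    then have "cmod (B f g) \<le> 0"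
      using b1[OF f g] True null[OF f] null[OF g] by auto
    then show ?thesis by (simp add: order_trans[OF _ mult_nonneg_nonneg])
  next
    case False
    define J where "J = I f * I g"
    have J: "J > 0" using False I0[of f] I0[of g] by (simp add: J_def zero_less_mult_iff less_le)
    \<comment> \<open>The modulus of \<open>N\<close> is 1 / J on the left edge and 1 / sqrt J on
      the right one, which cancels the edge bounds J and sqrt J of \<open>G\<close>.\<close>
    define N where "N z = exp (- (1 - z / 2) * of_real (ln J))" for z :: complex
    have nN: "cmod (N z) = J powr - (1 - Re z / 2)" for z
      using J by (simp add: N_def powr_def)
    \<comment> \<open>A crude bound for \<open>G\<close> on the closed strip: there the exponent p(1
      - Re z/2) stays between 0 and \<open>p\<close>, so each power of \<open>cmod c\<close> is at
      most 1 + |c|^p.\<close>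
    define C where "C = (\<Sum>c\<in>S f. (1 + cmod c powr p) * (\<Sum>c'\<in>S g. (1 + cmod c' powr p) * cmod (B (e f c) (e g c'))))"
    have powr_bd: "b powr s \<le> 1 + b powr r" if "0 \<le> s" "s \<le> r" "0 \<le> b" for b s r :: real
    proof (cases "b \<le> 1")
      case True
      then have "b powr s \<le> 1" using that by (simp add: powr_le1)
      then show ?thesis by (simp add: add_increasing2)
    next
      case False
      then have "b powr s \<le> b powr r" using that by (intro powr_mono) auto
      then show ?thesis by simp
    qed
    have "cmod (G (of_real t) * N (of_real t)) \<le> 1"
    proof (rule three_lines_unit[where f = "\<lambda>z. G z * N z"])
      show "(\<lambda>z. G z * N z) holomorphic_on UNIV"
        unfolding N_def by (intro holomorphic_intros holG) auto
      fix z :: complex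
      {
        assume z: "0 \<le> Re z" "Re z \<le> 1"
        have Hb: "cmod (H z c) \<le> 1 + cmod c powr p" for c
          unfolding nH using z p by (intro powr_bd) (auto simp: mult_left_le)
        have "cmod (G z) \<le> C"
          unfolding G_eq C_def using Hb
          by (intro order_trans[OF norm_sum] sum_mono)
             (auto simp: norm_mult intro!: mult_mono order_trans[OF norm_sum] sum_mono mult_right_mono)
        moreover have "J powr - (1 - Re z / 2) = (1 / J) powr (1 - Re z / 2)"
          unfolding powr_minus_divide using J by (simp add: powr_divide)
        moreover have "(1 / J) powr (1 - Re z / 2) \<le> 1 + (1 / J) powr 1"
          using J z by (intro powr_bd) auto
        ultimately show "cmod (G z * N z) \<le> C * (1 + (1 / J) powr 1)"
          unfolding norm_mult nN by (intro mult_mono) (auto intro: order_trans[OF norm_ge_zero])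
      }
      assume "Re z = 0 \<or> Re z = 1"
      then show "cmod (G z * N z) \<le> 1"
      proof
        assume z: "Re z = 0"
        have "cmod (G z) \<le> J"
          using b1[OF dV[OF f] dV[OF g], of z z] z by (simp add: G_def int1 f g J_def)
        then show ?thesis using J by (simp add: norm_mult nN z powr_minus field_simps)
      next
        assume z: "Re z = 1"
        have "cmod (G z) \<le> sqrt J"
          using b2[OF dV[OF f] dV[OF g], of z z] z by (simp add: G_def int2 f g J_def real_sqrt_mult)
        then show ?thesis using J by (simp add: norm_mult nN z powr_minus powr_half_sqrt field_simps)
      qed
    qed (use t in auto)
    moreover have "cmod (N (of_real t)) = J powr - (1 / p)"
      using nN[of "of_real t"] by (simp only: Re_complex_of_real t)
    ultimately have "cmod (B f g) \<le> J powr (1 / p)"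
      using J by (simp add: Idiff norm_mult powr_minus field_simps)
    then show ?thesis using I0 by (simp add: J_def powr_mult I_def)
  qed
qed

section \<open>Lebesgue spaces and duality\<close>

lemma Lp_space_iff:
  assumes p: "p > 0"
  shows "f \<in> Lp_space M (ennreal p) \<longleftrightarrow> f \<in> borel_measurable M \<and> integrable M (\<lambda>x. cmod (f x) powr p)"
proof -
  have "integrable M (\<lambda>x. cmod (f x) powr p) \<longleftrightarrow> (\<integral>\<^sup>+x. ennreal (cmod (f x) powr p) \<partial>M) < \<infinity>"
    if "f \<in> borel_measurable M"
    using that by (simp add: integrable_iff_bounded)
  moreover have "Lp_norm M (ennreal p) f < \<infinity> \<longleftrightarrow> (\<integral>\<^sup>+x. ennreal (cmod (f x) powr p) \<partial>M) < \<infinity>"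
    using p by (simp add: Lp_norm_def Let_def top.not_eq_extremum)
  ultimately show ?thesis by (auto simp: Lp_space_def)
qed

lemma Lp_norm_eq:
  assumes p: "p > 0" and f: "f \<in> Lp_space M (ennreal p)"
  shows "Lp_norm M (ennreal p) f = ennreal ((\<integral>x. cmod (f x) powr p \<partial>M) powr (1 / p))"
proof -
  have "integrable M (\<lambda>x. cmod (f x) powr p)" using f p by (simp add: Lp_space_iff)
  then have "(\<integral>\<^sup>+x. ennreal (cmod (f x) powr p) \<partial>M) = ennreal (\<integral>x. cmod (f x) powr p \<partial>M)"
    by (intro nn_integral_eq_integral) auto
  then show ?thesis using p by (simp add: Lp_norm_def Let_def)
qed

lemma L1_space_iff: "f \<in> Lp_space M 1 \<longleftrightarrow> integrable M f"
  using Lp_space_iff[of 1 f M] by (auto simp: integrable_norm_iff)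

lemma L1_norm_eq: "f \<in> Lp_space M 1 \<Longrightarrow> Lp_norm M 1 f = ennreal (\<integral>x. cmod (f x) \<partial>M)"
  using Lp_norm_eq[of 1 f M] by simp

lemma L2_space_iff:
  "f \<in> Lp_space M 2 \<longleftrightarrow> f \<in> borel_measurable M \<and> integrable M (\<lambda>x. (cmod (f x))\<^sup>2)"
  using Lp_space_iff[of 2 f M] by simp

lemma Linf_norm_le_iff:
  assumes "f \<in> borel_measurable M" "0 \<le> K"
  shows "Lp_norm M \<infinity> f \<le> ennreal K \<longleftrightarrow> (AE x in M. cmod (f x) \<le> K)"
proof
  assume le: "Lp_norm M \<infinity> f \<le> ennreal K"
  have "AE x in M. ennreal (cmod (f x)) \<le> Lp_norm M \<infinity> f"
    by (simp add: Lp_norm_def esssup_AE)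
  then show "AE x in M. cmod (f x) \<le> K"
    by eventually_elim (use le assms in \<open>auto dest: order_trans simp: ennreal_le_iff\<close>)
next
  assume "AE x in M. cmod (f x) \<le> K"
  then have "AE x in M. ennreal (cmod (f x)) \<le> ennreal K"
    by eventually_elim (rule ennreal_leI)
  then show "Lp_norm M \<infinity> f \<le> ennreal K"
    using assms by (auto simp: Lp_norm_def intro!: esssup_I)
qed

lemma Linf_space_iff:
  "f \<in> Lp_space M \<infinity> \<longleftrightarrow> f \<in> borel_measurable M \<and> (\<exists>K. AE x in M. cmod (f x) \<le> K)"
proof (intro iffI conjI)
  assume f: "f \<in> Lp_space M \<infinity>"
  then have "f \<in> borel_measurable M" "Lp_norm M \<infinity> f = ennreal (enn2real (Lp_norm M \<infinity> f))"
    by (auto simp: Lp_space_def)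
  then show "f \<in> borel_measurable M" "\<exists>K. AE x in M. cmod (f x) \<le> K"
    using Linf_norm_le_iff[of f M "enn2real (Lp_norm M \<infinity> f)"] by auto
next
  assume f: "f \<in> borel_measurable M \<and> (\<exists>K. AE x in M. cmod (f x) \<le> K)"
  then obtain K where "AE x in M. cmod (f x) \<le> K" by blast
  then have "AE x in M. cmod (f x) \<le> max 0 K" by eventually_elim auto
  then have "Lp_norm M \<infinity> f \<le> ennreal (max 0 K)"
    using f by (subst Linf_norm_le_iff) auto
  then show "f \<in> Lp_space M \<infinity>"
    using f by (auto simp: Lp_space_def intro: le_less_trans)
qed

section \<open>Norm bounds from pairings with simple functions\<close>

text \<open>The test functions of the duality arguments involve the sign of \<open>u\<close> and are
  not simple. They are bounded and vanish off a set \<open>E\<close> of finite measure on which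
  \<open>u\<close> is bounded too, so simple approximations pass to the limit on both sides by
  dominated convergence.\<close>

lemma pairing_bound_bounded:
  fixes u w :: "'a \<Rightarrow> complex"
  assumes test: "\<And>\<phi>. Bochner_Integration.simple_bochner_integrable M \<phi> \<Longrightarrow>
      cmod (\<integral>x. u x * \<phi> x \<partial>M) \<le> C * (\<integral>x. cmod (\<phi> x) powr p \<partial>M) powr (1 / p)"
    and p: "p > 0" and [measurable]: "u \<in> borel_measurable M" "w \<in> borel_measurable M"
    and E[measurable]: "E \<in> sets M" and fin: "emeasure M E < \<infinity>"
    and K: "\<And>x. x \<in> E \<Longrightarrow> cmod (u x) \<le> K" and L: "\<And>x. x \<in> E \<Longrightarrow> cmod (w x) \<le> L"
    and supp: "\<And>x. x \<notin> E \<Longrightarrow> w x = 0"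
  shows "cmod (\<integral>x. u x * w x \<partial>M) \<le> C * (\<integral>x. cmod (w x) powr p \<partial>M) powr (1 / p)"
proof -
  \<comment> \<open>Approximation relative to the base point 0 yields the bound by 2|w|. It keeps
    the supports of the approximations inside \<open>E\<close> and supplies the dominating
    functions.\<close>
  obtain s where s: "\<And>i. simple_function M (s i)" "\<And>x. x \<in> space M \<Longrightarrow> (\<lambda>i. s i x) \<longlonglongrightarrow> w x"
    and sb: "\<And>i x. x \<in> space M \<Longrightarrow> cmod (s i x) \<le> 2 * cmod (w x)"
    using borel_measurable_implies_sequence_metric[OF \<open>w \<in> borel_measurable M\<close>, of 0]
    unfolding norm_conv_dist by metis
  have [measurable]: "s i \<in> borel_measurable M" for i
    using s by (auto intro: borel_measurable_simple_function)
  have step: "Bochner_Integration.simple_bochner_integrable M (s i)" for i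
  proof (rule Bochner_Integration.simple_bochner_integrable.intros)
    have "{x\<in>space M. s i x \<noteq> 0} \<subseteq> E"
      using sb[of _ i] supp by fastforce
    then have "emeasure M {x\<in>space M. s i x \<noteq> 0} \<le> emeasure M E"
      by (intro emeasure_mono) auto
    with fin show "emeasure M {x\<in>space M. s i x \<noteq> 0} \<noteq> \<infinity>" by auto
  qed (use s in auto)
  have sL: "cmod (s i x) \<le> 2 * L * indicator E x" if "x \<in> space M" for i x
    using order_trans[OF sb[OF that, of i], of "2 * L * indicator E x"] L[of x] supp[of x]
    by (auto simp: indicator_def)
  have intE: "integrable M (\<lambda>x. c * indicator E x :: real)" for c
    using fin by (auto intro!: integrable_mult_right integrable_real_indicator)
  have l1: "(\<lambda>i. \<integral>x. u x * s i x \<partial>M) \<longlonglongrightarrow> (\<integral>x. u x * w x \<partial>M)"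
  proof (rule integral_dominated_convergence[where w = "\<lambda>x. K * (2 * L) * indicator E x"])
    show "AE x in M. (\<lambda>i. u x * s i x) \<longlonglongrightarrow> u x * w x"
      using s by (auto intro!: tendsto_intros AE_I2)
    show "AE x in M. norm (u x * s i x) \<le> K * (2 * L) * indicator E x" for i
    proof (rule AE_I2)
      fix x assume x: "x \<in> space M"
      show "norm (u x * s i x) \<le> K * (2 * L) * indicator E x"
      proof (cases "x \<in> E")
        case True
        then have "cmod (u x) * cmod (s i x) \<le> K * (2 * L)"
          using K[OF True] sL[OF x, of i] order_trans[OF norm_ge_zero K[OF True]]
          by (intro mult_mono) auto
        then show ?thesis using True by (simp add: norm_mult)
      qed (use sL[OF x, of i] in auto)
    qed
  qed (use intE in auto)
  have l2: "(\<lambda>i. \<integral>x. cmod (s i x) powr p \<partial>M) \<longlonglongrightarrow> (\<integral>x. cmod (w x) powr p \<partial>M)"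
  proof (rule integral_dominated_convergence[where w = "\<lambda>x. (2 * L) powr p * indicator E x"])
    show "AE x in M. (\<lambda>i. cmod (s i x) powr p) \<longlonglongrightarrow> cmod (w x) powr p"
      using s p by (auto intro!: tendsto_intros AE_I2 tendsto_powr')
    show "AE x in M. norm (cmod (s i x) powr p) \<le> (2 * L) powr p * indicator E x" for i
    proof (rule AE_I2)
      fix x assume x: "x \<in> space M"
      show "norm (cmod (s i x) powr p) \<le> (2 * L) powr p * indicator E x"
        using sL[OF x, of i] p by (cases "x \<in> E") (auto intro!: powr_mono2)
    qed
  qed (use intE in auto)
  have "(\<lambda>i. C * (\<integral>x. cmod (s i x) powr p \<partial>M) powr (1 / p)) \<longlonglongrightarrow> C * (\<integral>x. cmod (w x) powr p \<partial>M) powr (1 / p)"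
    using p by (intro tendsto_intros tendsto_powr' l2) auto
  then show ?thesis
    using test[OF step] by (intro LIMSEQ_le[OF tendsto_norm[OF l1]]) auto
qed

lemma borel_measurable_cnj [measurable (raw)]:
  "f \<in> borel_measurable M \<Longrightarrow> (\<lambda>x. cnj (f x)) \<in> borel_measurable M"
  by (intro borel_measurable_continuous_on[of cnj]) (auto intro: continuous_intros)

lemma mult_cnj_sgn: "z * cnj (sgn z) = of_real (cmod z)"
proof (cases "z = 0")
  case False
  then have "z * cnj (sgn z) = (z * cnj z) / of_real (cmod z)"
    by (simp add: sgn_div_norm scaleR_conv_of_real divide_inverse)
  also have "\<dots> = of_real (cmod z)"
    using False by (simp add: complex_norm_square[symmetric] power2_eq_square)
  finally show ?thesis .
qed simp

text \<open>The set where |u| exceeds \<open>C\<close> is the union of countably many pieces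
  \<open>E (i, j)\<close>, each of finite measure by the choice of \<open>A i\<close> and with |u|
  bounded by \<open>j\<close>. Pairing with the conjugate sign of \<open>u\<close> on one piece
  shows that the piece is null.\<close>

lemma (in sigma_finite_measure) Linf_bound_of_pairing:
  fixes u :: "'a \<Rightarrow> complex"
  assumes test: "\<And>\<phi>. Bochner_Integration.simple_bochner_integrable M \<phi> \<Longrightarrow>
      cmod (\<integral>x. u x * \<phi> x \<partial>M) \<le> C * (\<integral>x. cmod (\<phi> x) \<partial>M)"
    and u[measurable]: "u \<in> borel_measurable M" and C: "C \<ge> 0"
  shows "AE x in M. cmod (u x) \<le> C"
proof -
  obtain A :: "nat \<Rightarrow> 'a set" where A: "range A \<subseteq> sets M" "(\<Union>i. A i) = space M" "\<And>i. emeasure M (A i) \<noteq> \<infinity>"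
    using sigma_finite by metis
  have [measurable]: "A n \<in> sets M" for n using A by auto
  define E where "E n = {x\<in>space M. x \<in> A (fst n) \<and> C < cmod (u x) \<and> cmod (u x) \<le> real (snd n)}" for n
  have Em[measurable]: "E n \<in> sets M" for n unfolding E_def by measurable
  have fin: "emeasure M (E n) < \<infinity>" for n
  proof -
    have "emeasure M (E n) \<le> emeasure M (A (fst n))" by (intro emeasure_mono) (auto simp: E_def)
    also have "\<dots> < \<infinity>" using A(3) by (simp add: less_top)
    finally show ?thesis .
  qed
  have "AE x in M. x \<notin> E n" for n
  proof -
    define w where "w x = indicator (E n) x * cnj (sgn (u x))" for x
    have [measurable]: "w \<in> borel_measurable M" unfolding w_def sgn_div_norm by measurable
    have iE: "integrable M (\<lambda>x. indicator (E n) x * cmod (u x))"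
    proof (rule Bochner_Integration.integrable_bound[where f = "\<lambda>x. real (snd n) * indicator (E n) x"])
      show "integrable M (\<lambda>x. real (snd n) * indicator (E n) x)"
        using fin[of n] by (intro integrable_mult_right integrable_real_indicator) auto
    qed (auto simp: E_def indicator_def)
    have iC: "integrable M (\<lambda>x. C * indicator (E n) x)"
      using fin[of n] by (intro integrable_mult_right integrable_real_indicator) auto
    have "cmod (\<integral>x. u x * w x \<partial>M) \<le> C * (\<integral>x. cmod (w x) powr 1 \<partial>M) powr (1 / 1)"
      by (rule pairing_bound_bounded[of M u C 1 w "E n" "real (snd n)" 1])
         (use test fin in \<open>auto simp: w_def E_def norm_sgn\<close>)
    moreover have "u x * w x = of_real (indicator (E n) x * cmod (u x))" for x
      using mult_cnj_sgn[of "u x"] by (auto simp: w_def indicator_def)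
    then have "(\<integral>x. u x * w x \<partial>M) = of_real (\<integral>x. indicator (E n) x * cmod (u x) \<partial>M)"
      by (simp only: integral_complex_of_real)
    moreover have "cmod (w x) = indicator (E n) x" for x
      using C by (auto simp: w_def indicator_def E_def norm_sgn)
    ultimately have le: "(\<integral>x. indicator (E n) x * cmod (u x) \<partial>M) \<le> (\<integral>x. C * indicator (E n) x \<partial>M)"
      by simp
    have iD: "integrable M (\<lambda>x. indicator (E n) x * cmod (u x) - C * indicator (E n) x)"
      using iE iC by auto
    have nn: "0 \<le> indicator (E n) x * cmod (u x) - C * indicator (E n) x" for x
      by (auto simp: indicator_def E_def)
    \<comment> \<open>The integrand is nonnegative and strictly positive on \<open>E n\<close>; a
      vanishing integral therefore makes \<open>E n\<close> a null set.\<close>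
    have "(\<integral>x. indicator (E n) x * cmod (u x) - C * indicator (E n) x \<partial>M) = 0"
    proof (rule antisym)
      show "(\<integral>x. indicator (E n) x * cmod (u x) - C * indicator (E n) x \<partial>M) \<le> 0"
        using le iE iC by (subst Bochner_Integration.integral_diff) auto
    qed (rule Bochner_Integration.integral_nonneg[OF nn])
    then have "AE x in M. indicator (E n) x * cmod (u x) - C * indicator (E n) x = 0"
      using integral_nonneg_eq_0_iff_AE[OF iD] nn by auto
    then show ?thesis
      by eventually_elim (auto simp: E_def)
  qed
  then have "AE x in M. \<forall>n. x \<notin> E n" by (simp add: AE_all_countable)
  then show ?thesis
  proof (rule AE_mp, intro AE_I2 impI)
    fix x assume x: "x \<in> space M" "\<forall>n. x \<notin> E n"
    obtain i where "x \<in> A i" using A(2) x(1) by blast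
    moreover obtain j where "cmod (u x) \<le> real j" using real_arch_simple by blast
    ultimately show "cmod (u x) \<le> C" using x(2)[rule_format, of "(i, j)"] x by (auto simp: E_def)
  qed
qed

text \<open>The extremal function of Hoelder's inequality, the conjugate sign of \<open>u\<close>
  times |u|^(q-1), is used as test function on the truncation \<open>E n\<close>. Since (q - 1)p =
  q, the pairing becomes I \<le> C I^(1/p) for the truncated integral \<open>I\<close>, hence I
  \<le> C^q uniformly in \<open>n\<close>, and Fatou's lemma removes the truncation.\<close>

lemma (in sigma_finite_measure) Lp_bound_of_pairing:
  fixes u :: "'a \<Rightarrow> complex"
  assumes test: "\<And>\<phi>. Bochner_Integration.simple_bochner_integrable M \<phi> \<Longrightarrow>
      cmod (\<integral>x. u x * \<phi> x \<partial>M) \<le> C * (\<integral>x. cmod (\<phi> x) powr p \<partial>M) powr (1 / p)"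
    and u[measurable]: "u \<in> borel_measurable M" and C: "C \<ge> 0"
    and pq: "1 < p" "1 < q" "1 / p + 1 / q = 1"
  shows "integrable M (\<lambda>x. cmod (u x) powr q)"
    and "(\<integral>x. cmod (u x) powr q \<partial>M) powr (1 / q) \<le> C"
proof -
  obtain A :: "nat \<Rightarrow> 'a set" where A: "range A \<subseteq> sets M" "(\<Union>i. A i) = space M" "\<And>i. emeasure M (A i) \<noteq> \<infinity>" "incseq A"
    using sigma_finite_incseq by metis
  have [measurable]: "A n \<in> sets M" for n using A by auto
  have q: "(q - 1) * p = q" "1 - 1 / p = 1 / q" using pq by (auto simp: field_simps)
  define E where "E n = {x\<in>space M. x \<in> A n \<and> cmod (u x) \<le> real n}" for n
  have Em[measurable]: "E n \<in> sets M" for n unfolding E_def by measurable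
  have fin: "emeasure M (E n) < \<infinity>" for n
  proof -
    have "emeasure M (E n) \<le> emeasure M (A n)" by (intro emeasure_mono) (auto simp: E_def)
    also have "\<dots> < \<infinity>" using A(3) by (simp add: less_top)
    finally show ?thesis .
  qed
  have intE: "integrable M (\<lambda>x. indicator (E n) x * cmod (u x) powr q)" for n
  proof (rule Bochner_Integration.integrable_bound[where f = "\<lambda>x. real n powr q * indicator (E n) x"])
    show "integrable M (\<lambda>x. real n powr q * indicator (E n) x)"
      using fin[of n] by (intro integrable_mult_right integrable_real_indicator) auto
  qed (use pq in \<open>auto simp: E_def indicator_def intro!: powr_mono2\<close>)
  have bound: "(\<integral>x. indicator (E n) x * cmod (u x) powr q \<partial>M) \<le> C powr q" for n
  proof -
    define I where "I = (\<integral>x. indicator (E n) x * cmod (u x) powr q \<partial>M)"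
    define w where "w x = indicator (E n) x * (cnj (sgn (u x)) * of_real (cmod (u x) powr (q - 1)))" for x
    have [measurable]: "w \<in> borel_measurable M" unfolding w_def sgn_div_norm by measurable
    have nw: "cmod (w x) = indicator (E n) x * cmod (u x) powr (q - 1)" for x
      by (auto simp: w_def indicator_def norm_mult norm_sgn)
    have w0: "w x = 0" if "x \<notin> E n" for x using that by (simp add: w_def)
    have "cmod (\<integral>x. u x * w x \<partial>M) \<le> C * (\<integral>x. cmod (w x) powr p \<partial>M) powr (1 / p)"
      by (rule pairing_bound_bounded[of M u C p w "E n" "real n" "real n powr (q - 1)"])
         (use test fin pq w0 in \<open>auto simp: nw E_def intro!: powr_mono2\<close>)
    moreover have "u x * w x = of_real (indicator (E n) x * cmod (u x) powr q)" for x
    proof -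
      have "cmod (u x) * cmod (u x) powr (q - 1) = cmod (u x) powr q"
        using powr_mult_base[of "cmod (u x)" "q - 1"] by simp
      then have "u x * cnj (sgn (u x)) * of_real (cmod (u x) powr (q - 1)) = (of_real (cmod (u x) powr q) :: complex)"
        unfolding mult_cnj_sgn of_real_mult[symmetric] by simp
      then show ?thesis by (cases "x \<in> E n") (simp_all add: w_def mult.assoc)
    qed
    then have "(\<integral>x. u x * w x \<partial>M) = of_real I"
      unfolding I_def by (simp only: integral_complex_of_real)
    moreover have "cmod (w x) powr p = indicator (E n) x * cmod (u x) powr q" for x
      using q by (auto simp: nw indicator_def powr_powr)
    then have "(\<integral>x. cmod (w x) powr p \<partial>M) = I" by (simp add: I_def)
    moreover have I: "I \<ge> 0" by (simp add: I_def)
    ultimately have le: "I \<le> C * I powr (1 / p)" by simp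
    show ?thesis
    proof (cases "I = 0")
      case False
      with I have I: "I > 0" by simp
      have "I powr (1 - 1 / p) \<le> C"
        using le I by (simp add: powr_diff field_simps)
      then have "(I powr (1 / q)) powr q \<le> C powr q"
        unfolding q using pq by (intro powr_mono2) auto
      then show ?thesis using I pq by (simp add: powr_powr I_def)
    qed (simp add: I_def)
  qed
  \<comment> \<open>Because the sets \<open>A n\<close> increase, one index controls both set and
    height, and every point lies in \<open>E n\<close> for all large \<open>n\<close>.\<close>
  have lim: "liminf (\<lambda>n. ennreal (indicator (E n) x * cmod (u x) powr q)) = ennreal (cmod (u x) powr q)"
    if x: "x \<in> space M" for x
  proof (rule lim_imp_Liminf)
    obtain i where i: "x \<in> A i" using A(2) x by blast
    obtain j where j: "cmod (u x) \<le> real j" using real_arch_simple by blast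
    have "x \<in> E n" if "n \<ge> max i j" for n
      using that i j x incseqD[OF A(4), of i n] by (auto simp: E_def)
    then show "(\<lambda>n. ennreal (indicator (E n) x * cmod (u x) powr q)) \<longlonglongrightarrow> ennreal (cmod (u x) powr q)"
      by (intro tendsto_eventually eventually_sequentiallyI[of "max i j"]) auto
  qed simp
  have bound': "(\<integral>\<^sup>+x. ennreal (indicator (E n) x * cmod (u x) powr q) \<partial>M) \<le> ennreal (C powr q)" for n
    using intE[of n] bound[of n] by (subst nn_integral_eq_integral) (auto intro: ennreal_leI)
  have "(\<integral>\<^sup>+x. ennreal (cmod (u x) powr q) \<partial>M)
      = (\<integral>\<^sup>+x. liminf (\<lambda>n. ennreal (indicator (E n) x * cmod (u x) powr q)) \<partial>M)"
    by (intro nn_integral_cong) (simp only: lim)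
  also have "\<dots> \<le> liminf (\<lambda>n. \<integral>\<^sup>+x. ennreal (indicator (E n) x * cmod (u x) powr q) \<partial>M)"
    by (rule nn_integral_liminf) simp
  also have "\<dots> \<le> limsup (\<lambda>n. \<integral>\<^sup>+x. ennreal (indicator (E n) x * cmod (u x) powr q) \<partial>M)"
    by (rule Liminf_le_Limsup) simp
  also have "\<dots> \<le> ennreal (C powr q)"
    by (rule Limsup_bounded) (intro always_eventually allI bound')
  finally have le: "(\<integral>\<^sup>+x. ennreal (cmod (u x) powr q) \<partial>M) \<le> ennreal (C powr q)" .
  then show int: "integrable M (\<lambda>x. cmod (u x) powr q)"
    by (intro integrableI_bounded) (auto intro: le_less_trans)
  have "(\<integral>x. cmod (u x) powr q \<partial>M) \<le> C powr q"
    using le nn_integral_eq_integral[OF int] by (simp add: ennreal_le_iff)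
  then have "(\<integral>x. cmod (u x) powr q \<partial>M) powr (1 / q) \<le> (C powr q) powr (1 / q)"
    using pq by (intro powr_mono2) auto
  then show "(\<integral>x. cmod (u x) powr q \<partial>M) powr (1 / q) \<le> C"
    using C pq by (simp add: powr_powr)
qed

section \<open>Pairings and linear combinations in Lebesgue spaces\<close>

lemma step_in_L1: "Bochner_Integration.simple_bochner_integrable M f \<Longrightarrow> f \<in> Lp_space M 1"
  by (simp add: L1_space_iff integrableI_simple_bochner_integrable)

lemma step_in_L2: "Bochner_Integration.simple_bochner_integrable M f \<Longrightarrow> f \<in> Lp_space M 2"
  using simple_bochner_integrable_powr[of M f 2]
  by (auto simp: L2_space_iff dest: integrableI_simple_bochner_integrable)

lemma L2_pairing:
  assumes "f \<in> Lp_space M 2" "g \<in> Lp_space M 2"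
  shows "integrable M (\<lambda>x. f x * g x)"
    and "cmod (\<integral>x. f x * g x \<partial>M) \<le> sqrt (\<integral>x. (cmod (f x))\<^sup>2 \<partial>M) * sqrt (\<integral>x. (cmod (g x))\<^sup>2 \<partial>M)"
  using assms Holder_integral[of 2 2 f M g] by (auto simp: L2_space_iff powr_half_sqrt)

lemma Linf_pairing:
  fixes f g :: "'a \<Rightarrow> complex"
  assumes g: "g \<in> borel_measurable M" "AE x in M. cmod (g x) \<le> K" and f: "integrable M f"
  shows "integrable M (\<lambda>x. f x * g x)"
    and "cmod (\<integral>x. f x * g x \<partial>M) \<le> K * (\<integral>x. cmod (f x) \<partial>M)"
proof -
  have le: "AE x in M. cmod (f x * g x) \<le> K * cmod (f x)"
    using g(2) by eventually_elim (simp add: norm_mult mult_left_mono mult.commute[of K])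
  show int: "integrable M (\<lambda>x. f x * g x)"
  proof (rule Bochner_Integration.integrable_bound[where f = "\<lambda>x. K * cmod (f x)"])
    show "AE x in M. norm (f x * g x) \<le> norm (K * cmod (f x))"
      using le by eventually_elim auto
  qed (use f g in auto)
  have "cmod (\<integral>x. f x * g x \<partial>M) \<le> (\<integral>x. cmod (f x * g x) \<partial>M)"
    by (rule integral_norm_bound)
  also have "\<dots> \<le> (\<integral>x. K * cmod (f x) \<partial>M)"
    using le int f by (intro integral_mono_AE) auto
  finally show "cmod (\<integral>x. f x * g x \<partial>M) \<le> K * (\<integral>x. cmod (f x) \<partial>M)" by simp
qed

lemma L2_cnj: "f \<in> Lp_space M 2 \<Longrightarrow> (\<lambda>x. cnj (f x)) \<in> Lp_space M 2"
  by (auto simp: L2_space_iff intro: borel_measurable_cnj)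

lemma L2_lincomb:
  assumes "f \<in> Lp_space M 2" "g \<in> Lp_space M 2"
  shows "(\<lambda>x. c * f x + d * g x) \<in> Lp_space M 2"
  unfolding L2_space_iff
proof
  show [measurable]: "(\<lambda>x. c * f x + d * g x) \<in> borel_measurable M"
    using assms by (auto simp: L2_space_iff)
  have le: "(cmod (c * a + d * b))\<^sup>2 \<le> 2 * ((cmod c)\<^sup>2 * (cmod a)\<^sup>2) + 2 * ((cmod d)\<^sup>2 * (cmod b)\<^sup>2)" for a b
  proof -
    have "(cmod (c * a + d * b))\<^sup>2 \<le> (cmod (c * a) + cmod (d * b))\<^sup>2"
      by (intro power_mono norm_triangle_ineq) auto
    also have "\<dots> \<le> 2 * (cmod (c * a))\<^sup>2 + 2 * (cmod (d * b))\<^sup>2"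
      using sum_squares_bound[of "cmod (c * a)" "cmod (d * b)"] by (simp add: power2_sum)
    finally show ?thesis by (simp add: norm_mult power_mult_distrib)
  qed
  show "integrable M (\<lambda>x. (cmod (c * f x + d * g x))\<^sup>2)"
    by (rule Bochner_Integration.integrable_bound
        [where f = "\<lambda>x. 2 * ((cmod c)\<^sup>2 * (cmod (f x))\<^sup>2) + 2 * ((cmod d)\<^sup>2 * (cmod (g x))\<^sup>2)"])
       (use assms le in \<open>auto simp: L2_space_iff\<close>)
qed

section \<open>Unitary operators contracting the first Lebesgue space\<close>

text \<open>Sigma-finiteness serves the duality lemmas above. The contraction is assumed beyond
  simple functions because it is later applied to truncations of arbitrary integrable
  functions.\<close>

locale L2_unitary_L1_contraction = sigma_finite_measure M for M :: "'a measure" +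
  fixes F :: "('a \<Rightarrow> complex) \<Rightarrow> ('a \<Rightarrow> complex)"
  assumes unitary: "unitary_on_L2 M F"
    and contraction: "\<And>f. f \<in> Lp_space M 1 \<inter> Lp_space M 2 \<Longrightarrow> Lp_norm M \<infinity> (F f) \<le> Lp_norm M 1 f"
begin

lemma F_L2: "f \<in> Lp_space M 2 \<Longrightarrow> F f \<in> Lp_space M 2"
  and F_lincomb: "f \<in> Lp_space M 2 \<Longrightarrow> g \<in> Lp_space M 2 \<Longrightarrow>
    AE x in M. F (\<lambda>y. c * f y + d * g y) x = c * F f x + d * F g x"
  and F_inner: "f \<in> Lp_space M 2 \<Longrightarrow> g \<in> Lp_space M 2 \<Longrightarrow>
    (\<integral>x. F f x * cnj (F g x) \<partial>M) = (\<integral>x. f x * cnj (g x) \<partial>M)"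
  and F_surj: "g \<in> Lp_space M 2 \<Longrightarrow> \<exists>f\<in>Lp_space M 2. AE x in M. F f x = g x"
  using unitary unfolding unitary_on_L2_def by blast+

lemma F_measurable: "f \<in> Lp_space M 2 \<Longrightarrow> F f \<in> borel_measurable M"
  using F_L2 by (simp add: L2_space_iff)

lemma F_norm:
  assumes "f \<in> Lp_space M 2"
  shows "(\<integral>x. (cmod (F f x))\<^sup>2 \<partial>M) = (\<integral>x. (cmod (f x))\<^sup>2 \<partial>M)"
proof -
  have "(\<integral>x. of_real ((cmod (F f x))\<^sup>2) \<partial>M) = (\<integral>x. of_real ((cmod (f x))\<^sup>2) \<partial>M :: complex)"
    using F_inner[OF assms assms] by (simp only: complex_norm_square)
  then show ?thesis by (simp only: integral_complex_of_real of_real_eq_iff)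
qed

lemma F_bound:
  assumes f: "f \<in> Lp_space M 1" "f \<in> Lp_space M 2"
  shows "AE x in M. cmod (F f x) \<le> (\<integral>x. cmod (f x) \<partial>M)"
  using contraction[of f] f F_measurable[of f]
  by (subst Linf_norm_le_iff[symmetric]) (auto simp: L1_norm_eq)

text \<open>The L^1 endpoint is the contraction property paired with an integrable function, the L^2
  endpoint is Cauchy-Schwarz together with the isometry. Linearity of \<open>F\<close> almost
  everywhere suffices, since \<open>F\<close> enters only under the integral.\<close>

lemma F_interpolation:
  assumes p: "1 \<le> p" "p \<le> 2"
    and f: "Bochner_Integration.simple_bochner_integrable M f"
    and g: "Bochner_Integration.simple_bochner_integrable M g"
  shows "cmod (\<integral>x. F f x * g x \<partial>M)
    \<le> (\<integral>x. cmod (f x) powr p \<partial>M) powr (1 / p) * (\<integral>x. cmod (g x) powr p \<partial>M) powr (1 / p)"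
proof (rule bilinear_interpolation[where B = "\<lambda>f g. \<integral>x. F f x * g x \<partial>M"])
  fix f g h :: "'a \<Rightarrow> complex" and c :: complex
  assume "f \<in> {f. Bochner_Integration.simple_bochner_integrable M f}"
    and "g \<in> {f. Bochner_Integration.simple_bochner_integrable M f}"
  then have fg: "f \<in> Lp_space M 1" "f \<in> Lp_space M 2" "g \<in> Lp_space M 1" "g \<in> Lp_space M 2"
    by (auto intro: step_in_L1 step_in_L2)
  show "cmod (\<integral>x. F f x * g x \<partial>M) \<le> (\<integral>x. cmod (f x) \<partial>M) * (\<integral>x. cmod (g x) \<partial>M)"
    using Linf_pairing(2)[OF F_measurable F_bound, of f g] fg by (simp add: L1_space_iff mult.commute)
  show "cmod (\<integral>x. F f x * g x \<partial>M) \<le> sqrt (\<integral>x. (cmod (f x))\<^sup>2 \<partial>M) * sqrt (\<integral>x. (cmod (g x))\<^sup>2 \<partial>M)"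
    using L2_pairing(2)[OF F_L2, of f g] fg F_norm by simp
  assume "h \<in> {f. Bochner_Integration.simple_bochner_integrable M f}"
  then have h: "h \<in> Lp_space M 2"
    by (auto intro: step_in_L2)
  have fm: "F u \<in> borel_measurable M" "u \<in> borel_measurable M" if "u \<in> Lp_space M 2" for u
    using that F_measurable by (auto simp: L2_space_iff)
  have lin: "(\<lambda>x. f x + c * g x) \<in> Lp_space M 2"
    using L2_lincomb[of f M g 1 c] fg by simp
  have "AE x in M. F (\<lambda>x. f x + c * g x) x * h x = F f x * h x + c * (F g x * h x)"
    using F_lincomb[OF fg(2,4), of 1 c] by eventually_elim (simp add: algebra_simps)
  then have "(\<integral>x. F (\<lambda>x. f x + c * g x) x * h x \<partial>M) = (\<integral>x. F f x * h x + c * (F g x * h x) \<partial>M)"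
    using fm(1)[OF lin] fm[OF fg(2)] fm[OF fg(4)] fm[OF h] by (intro integral_cong_AE) auto
  then show "(\<integral>x. F (\<lambda>x. f x + c * g x) x * h x \<partial>M) = (\<integral>x. F f x * h x \<partial>M) + c * (\<integral>x. F g x * h x \<partial>M)"
    using L2_pairing(1)[OF F_L2 h] fg by simp
  have "(\<integral>x. F h x * (f x + c * g x) \<partial>M) = (\<integral>x. F h x * f x + c * (F h x * g x) \<partial>M)"
    by (simp add: algebra_simps)
  then show "(\<integral>x. F h x * (f x + c * g x) \<partial>M) = (\<integral>x. F h x * f x \<partial>M) + c * (\<integral>x. F h x * g x \<partial>M)"
    using L2_pairing(1)[OF F_L2[OF h]] fg by simp
qed (use p f g in auto)

text \<open>With \<open>F \<eta>\<close> equal to the conjugate of \<open>\<phi>\<close> almost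
  everywhere, preservation of the inner product makes the conjugate of \<open>\<eta>\<close> the
  transpose. Interpolation bounds its pairings with simple functions, and duality turns this into
  norm bounds. A single \<open>\<psi>\<close> must carry all of them: the supremum bound handles the
  L^1 component of the extension even when p > 1.\<close>

lemma transpose_exists:
  assumes phi: "Bochner_Integration.simple_bochner_integrable M \<phi>"
  shows "\<exists>\<psi>\<in>Lp_space M 2.
    (\<forall>h\<in>Lp_space M 2. (\<integral>x. F h x * \<phi> x \<partial>M) = (\<integral>x. h x * \<psi> x \<partial>M)) \<and>
    (AE x in M. cmod (\<psi> x) \<le> (\<integral>x. cmod (\<phi> x) \<partial>M)) \<and>
    (\<forall>p q. 1 < p \<and> p \<le> 2 \<and> 1 < q \<and> 1 / p + 1 / q = 1 \<longrightarrow>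
      integrable M (\<lambda>x. cmod (\<psi> x) powr q) \<and>
      (\<integral>x. cmod (\<psi> x) powr q \<partial>M) powr (1 / q) \<le> (\<integral>x. cmod (\<phi> x) powr p \<partial>M) powr (1 / p))"
proof -
  obtain \<eta> where eta: "\<eta> \<in> Lp_space M 2" "AE x in M. F \<eta> x = cnj (\<phi> x)"
    using F_surj[OF L2_cnj[OF step_in_L2[OF phi]]] by blast
  define \<psi> where "\<psi> x = cnj (\<eta> x)" for x
  have psi: "\<psi> \<in> Lp_space M 2" unfolding \<psi>_def using eta by (intro L2_cnj)
  have tr: "(\<integral>x. F h x * \<phi> x \<partial>M) = (\<integral>x. h x * \<psi> x \<partial>M)" if h: "h \<in> Lp_space M 2" for h
  proof -
    have "(\<integral>x. F h x * \<phi> x \<partial>M) = (\<integral>x. F h x * cnj (F \<eta> x) \<partial>M)"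
    proof (rule integral_cong_AE)
      show "AE x in M. F h x * \<phi> x = F h x * cnj (F \<eta> x)"
        using eta(2) by eventually_elim simp
    qed (use F_measurable[OF h] F_measurable[OF eta(1)] step_in_L2[OF phi] in \<open>auto simp: L2_space_iff\<close>)
    then show ?thesis using F_inner[OF h eta(1)] by (simp add: \<psi>_def)
  qed
  have bound: "cmod (\<integral>x. \<psi> x * s x \<partial>M) \<le> (\<integral>x. cmod (\<phi> x) powr p \<partial>M) powr (1 / p) * (\<integral>x. cmod (s x) powr p \<partial>M) powr (1 / p)"
    if "Bochner_Integration.simple_bochner_integrable M s" "1 \<le> p" "p \<le> 2" for s p
    using F_interpolation[OF that(2,3,1) phi] tr[OF step_in_L2[OF that(1)]] by (simp add: mult.commute)
  have pm: "\<psi> \<in> borel_measurable M" using psi by (simp add: L2_space_iff)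
  show ?thesis
  proof (intro bexI[OF _ psi] conjI ballI tr allI impI)
    show "AE x in M. cmod (\<psi> x) \<le> (\<integral>x. cmod (\<phi> x) \<partial>M)"
      using bound[of _ 1] pm by (intro Linf_bound_of_pairing) auto
    fix p q :: real
    assume pq: "1 < p \<and> p \<le> 2 \<and> 1 < q \<and> 1 / p + 1 / q = 1"
    note lp = Lp_bound_of_pairing[of \<psi> "(\<integral>x. cmod (\<phi> x) powr p \<partial>M) powr (1 / p)" p q, OF bound pm]
    show "integrable M (\<lambda>x. cmod (\<psi> x) powr q)"
      and "(\<integral>x. cmod (\<psi> x) powr q \<partial>M) powr (1 / q) \<le> (\<integral>x. cmod (\<phi> x) powr p \<partial>M) powr (1 / p)"
      using lp pq by auto
  qed
qed

lemma Linf_limit_pairing: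
  assumes s: "\<And>n. s n \<in> Lp_space M 2" and v: "v \<in> Lp_space M \<infinity>"
    and lim: "(\<lambda>n. Lp_norm M \<infinity> (\<lambda>x. F (s n) x - v x)) \<longlonglongrightarrow> 0"
    and phi: "Bochner_Integration.simple_bochner_integrable M \<phi>"
  shows "(\<lambda>n. \<integral>x. F (s n) x * \<phi> x \<partial>M) \<longlonglongrightarrow> (\<integral>x. v x * \<phi> x \<partial>M)"
proof (rule tendstoI)
  fix e :: real assume e: "e > 0"
  have ip: "integrable M \<phi>" using step_in_L1[OF phi] by (simp add: L1_space_iff)
  have vm: "v \<in> borel_measurable M" using v by (simp only: Linf_space_iff)
  obtain K where K: "AE x in M. cmod (v x) \<le> K" using v unfolding Linf_space_iff by blast
  define N where "N = (\<integral>x. cmod (\<phi> x) \<partial>M)"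
  have N: "N \<ge> 0" by (simp add: N_def)
  \<comment> \<open>Adding 1 avoids division by zero when \<open>\<phi>\<close> is null and makes
    the final inequality strict.\<close>
  define d where "d = e / (N + 1)"
  have d: "d > 0" "d * N < e" using N e by (auto simp: d_def field_simps)
  have "eventually (\<lambda>n. Lp_norm M \<infinity> (\<lambda>x. F (s n) x - v x) < ennreal d) sequentially"
    using lim d by (intro order_tendstoD) auto
  then show "eventually (\<lambda>n. dist (\<integral>x. F (s n) x * \<phi> x \<partial>M) (\<integral>x. v x * \<phi> x \<partial>M) < e) sequentially"
  proof eventually_elim
    case (elim n)
    have m: "(\<lambda>x. F (s n) x - v x) \<in> borel_measurable M"
      using F_measurable[OF s] vm by simp
    have "AE x in M. cmod (F (s n) x - v x) \<le> d"
      using elim d by (subst Linf_norm_le_iff[OF m, symmetric]) auto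
    from Linf_pairing(2)[OF m this ip]
    have "cmod (\<integral>x. \<phi> x * (F (s n) x - v x) \<partial>M) \<le> d * N" by (simp add: N_def)
    moreover have "(\<integral>x. \<phi> x * (F (s n) x - v x) \<partial>M) = (\<integral>x. F (s n) x * \<phi> x - v x * \<phi> x \<partial>M)"
      by (simp add: algebra_simps)
    moreover have "\<dots> = (\<integral>x. F (s n) x * \<phi> x \<partial>M) - (\<integral>x. v x * \<phi> x \<partial>M)"
      using L2_pairing(1)[OF F_L2[OF s] step_in_L2[OF phi]] Linf_pairing(1)[OF vm K ip]
      by (intro Bochner_Integration.integral_diff) (simp_all add: mult.commute)
    ultimately show ?case using d by (simp add: dist_norm)
  qed
qed

text \<open>The L^2 component is moved across by the transpose identity directly. For the L^1
  component the identity holds for each \<open>s n\<close>; one side converges because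
  \<open>F (s n)\<close> tends to \<open>v\<close> in L^\<infinity>, the other because
  \<open>\<psi>\<close> is bounded and \<open>s n\<close> tends to \<open>g\<close> in L^1.\<close>

lemma extension_value_pairing:
  assumes u: "is_extension_value M F f u" and f: "f \<in> borel_measurable M"
    and phi: "Bochner_Integration.simple_bochner_integrable M \<phi>"
    and psi: "\<psi> \<in> Lp_space M 2" "\<And>h. h \<in> Lp_space M 2 \<Longrightarrow> (\<integral>x. F h x * \<phi> x \<partial>M) = (\<integral>x. h x * \<psi> x \<partial>M)"
      "AE x in M. cmod (\<psi> x) \<le> K"
  shows "(\<integral>x. u x * \<phi> x \<partial>M) = (\<integral>x. f x * \<psi> x \<partial>M)"
proof -
  obtain g h v s where g: "g \<in> Lp_space M 1" and h: "h \<in> Lp_space M 2" and v: "v \<in> Lp_space M \<infinity>"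
    and fgh: "AE x in M. f x = g x + h x" and s: "\<And>n::nat. s n \<in> Lp_space M 1 \<inter> Lp_space M 2"
    and sg: "(\<lambda>n. Lp_norm M 1 (\<lambda>x. s n x - g x)) \<longlonglongrightarrow> 0"
    and sv: "(\<lambda>n. Lp_norm M \<infinity> (\<lambda>x. F (s n) x - v x)) \<longlonglongrightarrow> 0"
    and uvh: "AE x in M. u x = v x + F h x" and um: "u \<in> borel_measurable M"
    using u unfolding is_extension_value_def by blast
  have ip: "integrable M \<phi>" using step_in_L1[OF phi] by (simp add: L1_space_iff)
  have gi: "integrable M g" and si: "integrable M (s n)" for n
    using g s by (auto simp: L1_space_iff)
  have meas [measurable]: "\<psi> \<in> borel_measurable M" "v \<in> borel_measurable M" "h \<in> borel_measurable M"
    "F h \<in> borel_measurable M" "\<phi> \<in> borel_measurable M" "g \<in> borel_measurable M"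
    using psi v h F_measurable[OF h] ip gi unfolding L2_space_iff Linf_space_iff by auto
  have [measurable]: "u \<in> borel_measurable M" "f \<in> borel_measurable M" by fact+
  have pair_diff: "cmod ((\<integral>x. s n x * \<psi> x \<partial>M) - (\<integral>x. g x * \<psi> x \<partial>M)) \<le> K * (\<integral>x. cmod (s n x - g x) \<partial>M)" for n
  proof -
    have "(\<integral>x. s n x * \<psi> x \<partial>M) - (\<integral>x. g x * \<psi> x \<partial>M) = (\<integral>x. (s n x - g x) * \<psi> x \<partial>M)"
      using Linf_pairing(1)[OF meas(1) psi(3)] gi si
      by (subst Bochner_Integration.integral_diff[symmetric]) (auto simp: left_diff_distrib)
    then show ?thesis using Linf_pairing(2)[OF meas(1) psi(3), of "\<lambda>x. s n x - g x"] gi si by simp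
  qed
  have "Lp_norm M 1 (\<lambda>x. s n x - g x) = ennreal (\<integral>x. cmod (s n x - g x) \<partial>M)" for n
    using gi si by (intro L1_norm_eq) (simp add: L1_space_iff)
  then have "(\<lambda>n. \<integral>x. cmod (s n x - g x) \<partial>M) \<longlonglongrightarrow> 0"
    using sg by (simp add: ennreal_tendsto_0_iff)
  then have "(\<lambda>n. K * (\<integral>x. cmod (s n x - g x) \<partial>M)) \<longlonglongrightarrow> 0"
    by (rule tendsto_mult_right_zero)
  then have "(\<lambda>n. (\<integral>x. s n x * \<psi> x \<partial>M) - (\<integral>x. g x * \<psi> x \<partial>M)) \<longlonglongrightarrow> 0"
    by (rule Lim_null_comparison[rotated]) (intro always_eventually allI pair_diff)
  then have "(\<lambda>n. \<integral>x. s n x * \<psi> x \<partial>M) \<longlonglongrightarrow> (\<integral>x. g x * \<psi> x \<partial>M)"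
    by (rule LIM_zero_cancel)
  moreover have "(\<lambda>n. \<integral>x. s n x * \<psi> x \<partial>M) \<longlonglongrightarrow> (\<integral>x. v x * \<phi> x \<partial>M)"
    using Linf_limit_pairing[OF _ v sv phi] s psi(2) by simp
  ultimately have vg: "(\<integral>x. v x * \<phi> x \<partial>M) = (\<integral>x. g x * \<psi> x \<partial>M)"
    using LIMSEQ_unique by blast
  obtain Kv where Kv: "AE x in M. cmod (v x) \<le> Kv" using v unfolding Linf_space_iff by blast
  have "(\<integral>x. u x * \<phi> x \<partial>M) = (\<integral>x. v x * \<phi> x + F h x * \<phi> x \<partial>M)"
    using uvh by (intro integral_cong_AE) (auto simp: algebra_simps)
  also have "\<dots> = (\<integral>x. v x * \<phi> x \<partial>M) + (\<integral>x. F h x * \<phi> x \<partial>M)"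
    using L2_pairing(1)[OF F_L2[OF h] step_in_L2[OF phi]] Linf_pairing(1)[OF meas(2) Kv ip]
    by (intro Bochner_Integration.integral_add) (simp_all add: mult.commute)
  also have "\<dots> = (\<integral>x. g x * \<psi> x \<partial>M) + (\<integral>x. h x * \<psi> x \<partial>M)"
    using vg psi(2)[OF h] by simp
  also have "\<dots> = (\<integral>x. g x * \<psi> x + h x * \<psi> x \<partial>M)"
    using L2_pairing(1)[OF h psi(1)] Linf_pairing(1)[OF meas(1) psi(3) gi] by simp
  also have "\<dots> = (\<integral>x. f x * \<psi> x \<partial>M)"
    using fgh by (intro integral_cong_AE) (auto simp: algebra_simps)
  finally show ?thesis .
qed

text \<open>The estimate is proved for an arbitrary extension value, so it applies to whichever
  representative the choice operator selects. The case p = 1 is separate because its conjugate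
  exponent is infinite and the essential supremum replaces an integral.\<close>

lemma extension_value_bound:
  assumes u: "is_extension_value M F f u" and p: "1 \<le> p" "p \<le> 2" and f: "f \<in> Lp_space M (ennreal p)"
  shows "u \<in> Lp_space M (conj_exponent p) \<and> Lp_norm M (conj_exponent p) u \<le> Lp_norm M (ennreal p) f"
proof -
  have um: "u \<in> borel_measurable M" using u by (simp add: is_extension_value_def)
  have fm: "f \<in> borel_measurable M" and fi: "integrable M (\<lambda>x. cmod (f x) powr p)"
    using f p by (auto simp: Lp_space_iff)
  define C where "C = (\<integral>x. cmod (f x) powr p \<partial>M) powr (1 / p)"
  have C: "C \<ge> 0" "Lp_norm M (ennreal p) f = ennreal C" using Lp_norm_eq[of p f M] f p by (auto simp: C_def)
  show ?thesis
  proof (cases "p = 1")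
    case True
    have f1: "integrable M f" "C = (\<integral>x. cmod (f x) \<partial>M)" using fi fm True by (auto simp: C_def integrable_norm_iff)
    have "AE x in M. cmod (u x) \<le> C"
    proof (rule Linf_bound_of_pairing[OF _ um C(1)])
      fix \<phi> :: "'a \<Rightarrow> complex" assume phi: "Bochner_Integration.simple_bochner_integrable M \<phi>"
      obtain \<psi> where psi: "\<psi> \<in> Lp_space M 2"
        "\<forall>h\<in>Lp_space M 2. (\<integral>x. F h x * \<phi> x \<partial>M) = (\<integral>x. h x * \<psi> x \<partial>M)"
        "AE x in M. cmod (\<psi> x) \<le> (\<integral>x. cmod (\<phi> x) \<partial>M)"
        using transpose_exists[OF phi] by blast
      have "cmod (\<integral>x. f x * \<psi> x \<partial>M) \<le> (\<integral>x. cmod (\<phi> x) \<partial>M) * C"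
        using Linf_pairing(2)[OF _ psi(3) f1(1)] psi(1) by (simp add: L2_space_iff f1)
      then show "cmod (\<integral>x. u x * \<phi> x \<partial>M) \<le> C * (\<integral>x. cmod (\<phi> x) \<partial>M)"
        using extension_value_pairing[OF u fm phi psi(1) bspec[OF psi(2)] psi(3)] by (simp add: mult.commute)
    qed
    then have "Lp_norm M \<infinity> u \<le> ennreal C" using um C by (subst Linf_norm_le_iff) auto
    then show ?thesis using um C True
      by (auto simp: conj_exponent_def Lp_space_def intro: le_less_trans)
  next
    case False
    then have p1: "1 < p" using p by simp
    define q where "q = p / (p - 1)"
    have q: "1 < q" "1 / p + 1 / q = 1" using p1 by (auto simp: q_def field_simps)
    have ce: "conj_exponent p = ennreal q" using False by (simp add: conj_exponent_def q_def)
    have test: "cmod (\<integral>x. u x * \<phi> x \<partial>M) \<le> C * (\<integral>x. cmod (\<phi> x) powr p \<partial>M) powr (1 / p)"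
      if phi: "Bochner_Integration.simple_bochner_integrable M \<phi>" for \<phi>
    proof -
      obtain \<psi> where psi: "\<psi> \<in> Lp_space M 2"
        "\<forall>h\<in>Lp_space M 2. (\<integral>x. F h x * \<phi> x \<partial>M) = (\<integral>x. h x * \<psi> x \<partial>M)"
        "AE x in M. cmod (\<psi> x) \<le> (\<integral>x. cmod (\<phi> x) \<partial>M)"
        and psiq: "integrable M (\<lambda>x. cmod (\<psi> x) powr q)"
          "(\<integral>x. cmod (\<psi> x) powr q \<partial>M) powr (1 / q) \<le> (\<integral>x. cmod (\<phi> x) powr p \<partial>M) powr (1 / p)"
        using transpose_exists[OF phi] p1 p(2) q by blast
      have "cmod (\<integral>x. f x * \<psi> x \<partial>M) \<le> C * (\<integral>x. cmod (\<psi> x) powr q \<partial>M) powr (1 / q)"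
        unfolding C_def using psi(1) by (intro Holder_integral(2) p1 q fm fi psiq) (simp add: L2_space_iff)
      also have "\<dots> \<le> C * (\<integral>x. cmod (\<phi> x) powr p \<partial>M) powr (1 / p)"
        using psiq C by (intro mult_left_mono)
      finally show ?thesis using extension_value_pairing[OF u fm phi psi(1) bspec[OF psi(2)] psi(3)] by simp
    qed
    note lp = Lp_bound_of_pairing[OF test um C(1) p1 q]
    have uq: "u \<in> Lp_space M (ennreal q)" using lp(1) um q by (simp add: Lp_space_iff)
    moreover have "Lp_norm M (ennreal q) u \<le> ennreal C"
      using Lp_norm_eq[OF _ uq] q lp(2) by (simp add: ennreal_leI)
    ultimately show ?thesis using C by (simp add: ce)
  qed
qed

section \<open>Existence of extension values\<close>

text \<open>The truncations of \<open>g\<close> at height \<open>n\<close> are square integrable,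
  since their squared modulus is at most n|g|, and they converge to \<open>g\<close> in L^1. The
  contraction makes their images uniformly Cauchy off a null set, so the pointwise limit serves as
  \<open>v\<close>.\<close>

lemma extension_of_L1_exists:
  assumes gi: "integrable M g"
  obtains v s where "v \<in> Lp_space M \<infinity>" "\<And>n::nat. s n \<in> Lp_space M 1 \<inter> Lp_space M 2"
    "(\<lambda>n. Lp_norm M 1 (\<lambda>x. s n x - g x)) \<longlonglongrightarrow> 0"
    "(\<lambda>n. Lp_norm M \<infinity> (\<lambda>x. F (s n) x - v x)) \<longlonglongrightarrow> 0"
proof -
  have gm[measurable]: "g \<in> borel_measurable M" using gi by simp
  define s where "s n x = (if cmod (g x) \<le> real n then g x else 0)" for n :: nat and x
  have [measurable]: "s n \<in> borel_measurable M" for n unfolding s_def by measurable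
  have s1: "integrable M (s n)" for n
    by (rule Bochner_Integration.integrable_bound[OF gi]) (auto simp: s_def)
  have s2: "s n \<in> Lp_space M 2" for n
  proof -
    have "integrable M (\<lambda>x. (cmod (s n x))\<^sup>2)"
    proof (rule Bochner_Integration.integrable_bound[where f = "\<lambda>x. real n * cmod (g x)"])
      show "AE x in M. norm ((cmod (s n x))\<^sup>2) \<le> norm (real n * cmod (g x))"
        by (intro AE_I2) (auto simp: s_def power2_eq_square intro: mult_right_mono)
    qed (use gi in auto)
    then show ?thesis by (simp add: L2_space_iff)
  qed
  define d where "d n = (\<integral>x. cmod (s n x - g x) \<partial>M)" for n
  have d0: "d \<longlonglongrightarrow> 0"
  proof -
    have "d \<longlonglongrightarrow> (\<integral>x. 0 \<partial>M)" unfolding d_def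
    proof (rule integral_dominated_convergence[where w = "\<lambda>x. cmod (g x)"])
      show "AE x in M. (\<lambda>n. cmod (s n x - g x)) \<longlonglongrightarrow> 0"
      proof (rule AE_I2)
        fix x
        obtain N :: nat where N: "cmod (g x) \<le> real N" using real_arch_simple by blast
        show "(\<lambda>n. cmod (s n x - g x)) \<longlonglongrightarrow> 0"
          by (rule tendsto_eventually, rule eventually_sequentiallyI[of N]) (use N in \<open>auto simp: s_def\<close>)
      qed
    qed (use gi in \<open>auto simp: s_def\<close>)
    then show ?thesis by simp
  qed
  have Fm[measurable]: "F (s n) \<in> borel_measurable M" for n using F_measurable s2 by blast
  \<comment> \<open>The difference of two truncations lives where n < |g| \<le> m, and there its
    modulus is that of \<open>s n x - g x\<close>. Hence the bound \<open>d n\<close> is uniform in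
    \<open>m\<close>.\<close>
  have diff: "AE x in M. cmod (F (s n) x - F (s m) x) \<le> d n" if "n \<le> m" for n m
  proof -
    let ?r = "\<lambda>x. 1 * s n x + (-1) * s m x"
    have r: "?r \<in> Lp_space M 1" "?r \<in> Lp_space M 2"
      using s1 L2_lincomb[OF s2 s2, of 1 n "-1" m] by (simp_all add: L1_space_iff)
    have le: "(\<integral>x. cmod (?r x) \<partial>M) \<le> d n"
      unfolding d_def
    proof (rule integral_mono)
      show "cmod (?r x) \<le> cmod (s n x - g x)" for x
        using that by (auto simp: s_def norm_minus_commute)
    qed (use s1 gi in auto)
    show ?thesis
      using F_bound[OF r] F_lincomb[OF s2 s2, of 1 n "-1" m] by eventually_elim (use le in auto)
  qed
  \<comment> \<open>Where the sequence diverges \<open>lim\<close> has no meaningful value; this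
    happens only on a null set, and \<open>v\<close> is measurable nevertheless.\<close>
  define v where "v x = lim (\<lambda>n. F (s n) x)" for x
  have vm[measurable]: "v \<in> borel_measurable M" unfolding v_def by measurable
  \<comment> \<open>Countability of the index pairs provides one exceptional null set for all of
    them.\<close>
  have "AE x in M. \<forall>n m. n \<le> m \<longrightarrow> cmod (F (s n) x - F (s m) x) \<le> d n"
    unfolding AE_all_countable using diff by auto
  then have lim: "AE x in M. \<forall>n. cmod (F (s n) x - v x) \<le> d n"
  proof eventually_elim
    case (elim x)
    have "Cauchy (\<lambda>n. F (s n) x)"
    proof (rule CauchyI')
      fix e :: real assume "e > 0"
      then obtain N where N: "\<And>n. n \<ge> N \<Longrightarrow> d n < e"
        using order_tendstoD(2)[OF d0] by (auto simp: eventually_sequentially)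
      then have "\<forall>m\<ge>N. \<forall>n>m. cmod (F (s m) x - F (s n) x) < e"
        using elim by (meson le_less_trans less_imp_le)
      then show "\<exists>N. \<forall>m\<ge>N. \<forall>n>m. dist (F (s m) x) (F (s n) x) < e" by (auto simp: dist_norm)
    qed
    then have "(\<lambda>n. F (s n) x) \<longlonglongrightarrow> v x"
      unfolding v_def by (simp add: Cauchy_convergent_iff convergent_LIMSEQ_iff)
    then have "(\<lambda>m. cmod (F (s n) x - F (s m) x)) \<longlonglongrightarrow> cmod (F (s n) x - v x)" for n
      by (intro tendsto_intros)
    from LIMSEQ_le_const2[OF this] show ?case
      using elim by blast
  qed
  have dn: "d n \<ge> 0" for n by (simp add: d_def)
  show ?thesis
  proof (rule that[of v s])
    have "AE x in M. cmod (v x) \<le> (\<integral>x. cmod (s 0 x) \<partial>M) + d 0"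
    proof -
      have "AE x in M. cmod (F (s 0) x) \<le> (\<integral>x. cmod (s 0 x) \<partial>M)"
        using s1 s2 by (intro F_bound) (auto simp: L1_space_iff)
      with lim show ?thesis
      proof eventually_elim
        case (elim x)
        have "cmod (F (s 0) x - v x) \<le> d 0" using elim by blast
        then show ?case
          using elim norm_triangle_sub[of "v x" "F (s 0) x"] norm_minus_commute[of "v x" "F (s 0) x"]
          by linarith
      qed
    qed
    then show "v \<in> Lp_space M \<infinity>" using vm unfolding Linf_space_iff by blast
    show "s n \<in> Lp_space M 1 \<inter> Lp_space M 2" for n using s1 s2 by (simp add: L1_space_iff)
    have "Lp_norm M 1 (\<lambda>x. s n x - g x) = ennreal (d n)" for n
      unfolding d_def using s1 gi by (intro L1_norm_eq) (simp add: L1_space_iff)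
    then show "(\<lambda>n. Lp_norm M 1 (\<lambda>x. s n x - g x)) \<longlonglongrightarrow> 0"
      using d0 dn by (simp add: ennreal_tendsto_0_iff)
    have le: "Lp_norm M \<infinity> (\<lambda>x. F (s n) x - v x) \<le> ennreal (d n)" for n
      using lim dn by (subst Linf_norm_le_iff) auto
    have h0: "(\<lambda>n. ennreal (d n)) \<longlonglongrightarrow> 0"
      using d0 dn by (simp add: ennreal_tendsto_0_iff)
    show "(\<lambda>n. Lp_norm M \<infinity> (\<lambda>x. F (s n) x - v x)) \<longlonglongrightarrow> 0"
      by (rule tendsto_sandwich[OF _ _ tendsto_const h0]) (intro always_eventually allI zero_le le)+
  qed
qed

text \<open>Splitting \<open>f\<close> at height 1 places it in L^1 + L^2: where |f| > 1 one has |f|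
  \<le> |f|^p because p \<ge> 1, and elsewhere |f|^2 \<le> |f|^p because p \<le> 2.\<close>

lemma extension_value_exists:
  assumes p: "1 \<le> p" "p \<le> 2" and f: "f \<in> Lp_space M (ennreal p)"
  shows "\<exists>u. is_extension_value M F f u"
proof -
  have fm[measurable]: "f \<in> borel_measurable M" and fi: "integrable M (\<lambda>x. cmod (f x) powr p)"
    using f p by (auto simp: Lp_space_iff)
  define g where "g x = (if cmod (f x) \<le> 1 then 0 else f x)" for x
  define h where "h x = (if cmod (f x) \<le> 1 then f x else 0)" for x
  have [measurable]: "g \<in> borel_measurable M" "h \<in> borel_measurable M"
    unfolding g_def h_def by measurable
  have gi: "integrable M g"
  proof (rule Bochner_Integration.integrable_bound[OF fi])
    show "AE x in M. cmod (g x) \<le> norm (cmod (f x) powr p)"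
    proof (rule AE_I2)
      fix x
      show "cmod (g x) \<le> norm (cmod (f x) powr p)"
        using p powr_mono[of 1 p "cmod (f x)"] by (auto simp: g_def)
    qed
  qed simp
  have h2: "h \<in> Lp_space M 2"
    unfolding L2_space_iff
  proof
    show "integrable M (\<lambda>x. (cmod (h x))\<^sup>2)"
    proof (rule Bochner_Integration.integrable_bound[OF fi])
      show "AE x in M. norm ((cmod (h x))\<^sup>2) \<le> norm (cmod (f x) powr p)"
      proof (rule AE_I2)
        fix x
        show "norm ((cmod (h x))\<^sup>2) \<le> norm (cmod (f x) powr p)"
          using p powr_mono'[of p 2 "cmod (f x)"] by (auto simp: h_def)
      qed
    qed simp
  qed simp
  obtain v s where v: "v \<in> Lp_space M \<infinity>" and s: "\<And>n::nat. s n \<in> Lp_space M 1 \<inter> Lp_space M 2"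
    "(\<lambda>n. Lp_norm M 1 (\<lambda>x. s n x - g x)) \<longlonglongrightarrow> 0"
    "(\<lambda>n. Lp_norm M \<infinity> (\<lambda>x. F (s n) x - v x)) \<longlonglongrightarrow> 0"
    using extension_of_L1_exists[OF gi] by blast
  have um: "(\<lambda>x. v x + F h x) \<in> borel_measurable M"
    using F_measurable[OF h2] v unfolding Linf_space_iff by (intro borel_measurable_add) auto
  have fgh: "AE x in M. f x = g x + h x" by (simp add: g_def h_def)
  have g1: "g \<in> Lp_space M 1" using gi by (simp add: L1_space_iff)
  have "is_extension_value M F f (\<lambda>x. v x + F h x)"
    unfolding is_extension_value_def
    by (intro conjI um bexI[OF _ g1] bexI[OF _ h2] bexI[OF _ v] exI[of _ s] fgh allI s AE_I2 refl)
  then show ?thesis by blast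
qed

theorem Hausdorff_Young:
  assumes "1 \<le> p" "p \<le> 2" "f \<in> Lp_space M (ennreal p)"
  shows "extend_L1_L2 M F f \<in> Lp_space M (conj_exponent p) \<and>
    Lp_norm M (conj_exponent p) (extend_L1_L2 M F f) \<le> Lp_norm M (ennreal p) f"
  unfolding extend_L1_L2_def
  using extension_value_bound[OF someI_ex[OF extension_value_exists[OF assms]] assms] .

end

section \<open>The generalized Fourier transform\<close>

lemma borel_measurable_ka_weight [measurable]: "ka_weight Rp k a \<in> borel_measurable borel"
  unfolding ka_weight_def by measurable

text \<open>The weight is a real number at every point, also at the origin when a < 2, so the
  density is finite and inherits sigma-finiteness from Lebesgue measure.\<close>

lemma sigma_finite_ka_measure: "sigma_finite_measure (ka_measure Rp k a)"
  unfolding ka_measure_def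
  by (subst sigma_finite_measure.sigma_finite_iff_density_finite[OF sigma_finite_lborel]) auto

theorem proposition2p10:
  fixes R Rp :: "(real^'n) set"
    and k :: "real^'n \<Rightarrow> real"
    and a p :: real
    and F :: "(real^'n \<Rightarrow> complex) \<Rightarrow> (real^'n \<Rightarrow> complex)"
  assumes "reduced_root_system R"
    and "positive_subsystem R Rp"
    and "multiplicity_function R k"
    and "a > 0"
    and "a + 2 * mult_sum Rp k + real CARD('n) > 2"
    and "CARD('n) = 1 \<or> a = 1 \<or> a = 2 \<or>
         ((\<forall>\<alpha>\<in>R. k \<alpha> = 0) \<and> (\<exists>m::nat. m \<ge> 1 \<and> a = 2 / real m))"
    and "is_ka_fourier Rp k a F"
    and "\<forall>f \<in> Lp_space (ka_measure Rp k a) 1 \<inter> Lp_space (ka_measure Rp k a) 2.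
           Lp_norm (ka_measure Rp k a) \<infinity> (F f) \<le> Lp_norm (ka_measure Rp k a) 1 f"
    and "1 \<le> p" and "p \<le> 2"
  shows "\<forall>f \<in> Lp_space (ka_measure Rp k a) (ennreal p).
           extend_L1_L2 (ka_measure Rp k a) F f
             \<in> Lp_space (ka_measure Rp k a) (conj_exponent p) \<and>
           Lp_norm (ka_measure Rp k a) (conj_exponent p) (extend_L1_L2 (ka_measure Rp k a) F f)
             \<le> Lp_norm (ka_measure Rp k a) (ennreal p) f"
proof -
  interpret sigma_finite_measure "ka_measure Rp k a" by (rule sigma_finite_ka_measure)
  interpret L2_unitary_L1_contraction "ka_measure Rp k a" F
    using assms by unfold_locales (auto simp: is_ka_fourier_def)
  show ?thesis using Hausdorff_Young assms by blast
qed

end
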